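(* Let $B : \mathbb{E} \to \mathbb{E}^*$ be self-adjoint positive definite, where $\dim \mathbb{E} = n$, let $\mu, L > 0$ and $M \ge 0$, and let $f : \mathbb{E} \to \mathbb{R}$ be a twice differentiable function such that $\mu B \preceq \nabla^2 f(x) \preceq L B$ for all $x \in \mathbb{E}$ and $$\nabla^2 f(y) - \nabla^2 f(x) \preceq M \|y - x\|_z \nabla^2 f(w) \qquad \text{for all } x,y,z,w \in \mathbb{E}.$$ Let $x_0 \in \mathbb{E}$ and $\phi_k \in [0,1]$ ($k \ge 0$), and let the sequences $(x_k)$, $(G_k)$, $(u_k)$, $(J_k)$ be generated by $G_0 = L B$ and, for $k \ge 0$, $$x_{k+1} = x_k - G_k^{-1}\nabla f(x_k), \quad u_k = x_{k+1} - x_k, \quad J_k = \int_0^1 \nabla^2 f(x_k + t u_k)\,dt, \quad G_{k+1} = \mathrm{Broyd}_{\phi_k}(J_k, G_k, u_k).$$ Suppose that $$M \lambda_f(x_0) \le \frac{\ln\frac32}{4}\,\frac{\mu}{L}.$$ Then, for all $k \ge 1$, $$\lambda_f(x_k) \le \frac{1}{\prod_{i=0}^{k-1}\left(\phi_i\frac{\mu}{L} + 1 - \phi_i\right)^{1/2}} \left(\frac{11 n L}{\mu k}\right)^{k/2}\lambda_f(x_0).$$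
   Context: $\mathbb{E}$ is an $n$-dimensional real vector space with dual $\mathbb{E}^*$, and $\langle s, x\rangle$ is the value of $s \in \mathbb{E}^*$ at $x \in \mathbb{E}$. For self-adjoint linear operators $A, A_1 : \mathbb{E} \to \mathbb{E}^*$, $A \preceq A_1$ means $\langle (A_1 - A) x, x\rangle \ge 0$ for all $x \in \mathbb{E}$. The gradient $\nabla f(x)$ is an element of $\mathbb{E}^*$ and the Hessian $\nabla^2 f(x)$ is a self-adjoint operator $\mathbb{E}\to\mathbb{E}^*$. Notation: $\|h\|_x = \langle \nabla^2 f(x) h, h\rangle^{1/2}$ for $h, x \in \mathbb{E}$, and $\lambda_f(x) = \langle \nabla f(x), \nabla^2 f(x)^{-1}\nabla f(x)\rangle^{1/2}$. For self-adjoint positive definite $A, G : \mathbb{E} \to \mathbb{E}^*$, $u \in \mathbb{E}\setminus\{0\}$ and $\phi \in \mathbb{R}$, define $$\mathrm{Broyd}_\phi(A,G,u) = \phi\left[ G - \frac{A u u^* G + G u u^* A}{\langle A u,u\rangle} + \left(\frac{\langle G u,u\rangle}{\langle A u,u\rangle} + 1\right)\frac{A u u^* A}{\langle A u,u\rangle}\right] + (1-\phi)\left[ G - \frac{G u u^* G}{\langle G u,u\rangle} + \frac{A u u^* A}{\langle A u,u\rangle}\right],$$ where $A u u^* G$ denotes the operator $h \mapsto \langle G u, h\rangle A u$, and similarly for the other products; and $\mathrm{Broyd}_\phi(A,G,0) = G$. *)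

theory Defs
  imports "HOL-Analysis.Analysis"
begin

(* The n-dimensional space E is a type 'a :: euclidean_space with n = DIM('a); its dual is kept
   as a separate space, so that s x is the pairing of s with x.  The inner product of 'a is not
   used to identify E with its dual; it only supplies the (unique) linear topology of E. *)

type_synonym 'a dual = "'a \<Rightarrow>\<^sub>L real"

type_synonym 'a dual_op = "'a \<Rightarrow>\<^sub>L 'a dual"

definition self_adjoint :: "'a::real_normed_vector dual_op \<Rightarrow> bool" where
  "self_adjoint A \<longleftrightarrow> (\<forall>x y. A x y = A y x)"

definition positive_definite :: "'a::real_normed_vector dual_op \<Rightarrow> bool" where
  "positive_definite A \<longleftrightarrow> (\<forall>x. x \<noteq> 0 \<longrightarrow> A x x > 0)"

definition op_le :: "'a::real_normed_vector dual_op \<Rightarrow> 'a dual_op \<Rightarrow> bool" (infix "\<preceq>" 50) where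
  "A \<preceq> A1 \<longleftrightarrow> (\<forall>x. (A1 - A) x x \<ge> 0)"

(* The Frechet derivative as a bounded linear map.  As with frechet_derivative, the value is only
   meaningful where the function is differentiable. *)
definition blinfun_deriv ::
    "('a::real_normed_vector \<Rightarrow> 'b::real_normed_vector) \<Rightarrow> 'a \<Rightarrow> 'a \<Rightarrow>\<^sub>L 'b" where
  "blinfun_deriv f x = Blinfun (frechet_derivative f (at x))"

definition grad :: "('a::real_normed_vector \<Rightarrow> real) \<Rightarrow> 'a \<Rightarrow> 'a dual" where
  "grad f = blinfun_deriv f"

definition hess :: "('a::real_normed_vector \<Rightarrow> real) \<Rightarrow> 'a \<Rightarrow> 'a dual_op" where
  "hess f = blinfun_deriv (grad f)"

definition twice_differentiable :: "('a::real_normed_vector \<Rightarrow> real) \<Rightarrow> bool" where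
  "twice_differentiable f \<longleftrightarrow>
     (\<forall>x. f differentiable (at x)) \<and> (\<forall>x. grad f differentiable (at x))"

(* Inverse operator from the dual back to the space; only meaningful for bijective A. *)
definition op_inv :: "'a::real_normed_vector dual_op \<Rightarrow> 'a dual \<Rightarrow> 'a" where
  "op_inv A = inv (blinfun_apply A)"

definition local_norm :: "('a::real_normed_vector \<Rightarrow> real) \<Rightarrow> 'a \<Rightarrow> 'a \<Rightarrow> real" where
  "local_norm f x h = sqrt (hess f x h h)"

definition newton_decrement :: "('a::real_normed_vector \<Rightarrow> real) \<Rightarrow> 'a \<Rightarrow> real" where
  "newton_decrement f x = sqrt (grad f x (op_inv (hess f x) (grad f x)))"

(* For self-adjoint A and G, the product A u u* G is outer (A u) (G u). *)
definition outer :: "'a::real_normed_vector dual \<Rightarrow> 'a dual \<Rightarrow> 'a dual_op" where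
  "outer s r = blinfun_scaleR_left s o\<^sub>L r"

lemma outer_apply: "outer s r h = r h *\<^sub>R s"
  by (simp add: outer_def)

definition broyd ::
    "real \<Rightarrow> 'a::real_normed_vector dual_op \<Rightarrow> 'a dual_op \<Rightarrow> 'a \<Rightarrow> 'a dual_op" where
  "broyd \<phi> A G u =
     (if u = 0 then G else
        \<phi> *\<^sub>R (G - (1 / A u u) *\<^sub>R (outer (A u) (G u) + outer (G u) (A u))
                + (G u u / A u u + 1) *\<^sub>R ((1 / A u u) *\<^sub>R outer (A u) (A u)))
        + (1 - \<phi>) *\<^sub>R (G - (1 / G u u) *\<^sub>R outer (G u) (G u)
                + (1 / A u u) *\<^sub>R outer (A u) (A u)))"

end

theory Submission
  imports Defs
begin

text \<open>
  Write \<open>H\<^sub>k = \<nabla>\<^sup>2 f(x\<^sub>k)\<close>, \<open>\<lambda>\<^sub>k = \<lambda>\<^sub>f(x\<^sub>k)\<close>, \<open>r\<^sub>k = \<parallel>u\<^sub>k\<parallel>\<close> in the local norm at \<open>x\<^sub>k\<close>, and \<open>\<eta> = L/\<mu>\<close>.  Since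
  \<open>G\<^sub>k u\<^sub>k = -\<nabla>f(x\<^sub>k)\<close> and \<open>\<nabla>f(x\<^sub>k\<^sub>+\<^sub>1) = \<nabla>f(x\<^sub>k) + J\<^sub>k u\<^sub>k\<close>, the new gradient is the residual \<open>-(G\<^sub>k - J\<^sub>k) u\<^sub>k\<close>.
  Let \<open>\<theta>\<^sub>k\<close> be the quotient of the lengths of \<open>(G\<^sub>k - J\<^sub>k) u\<^sub>k\<close> and \<open>G\<^sub>k u\<^sub>k\<close> in the norm dual to \<open>J\<^sub>k\<close>.  By strong
  self-concordance \<open>J\<^sub>k\<close> differs from \<open>H\<^sub>k\<close> and from \<open>H\<^sub>k\<^sub>+\<^sub>1\<close> by a factor of at most \<open>1 + M r\<^sub>k / 2\<close>
  (\<open>mean_hess_bounds\<close>), hence \<open>\<lambda>\<^sub>k\<^sub>+\<^sub>1 \<le> exp (M r\<^sub>k / 2) \<theta>\<^sub>k \<lambda>\<^sub>k\<close> (\<open>lam_Suc_sq\<close>).  The rate is governed by the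
  product of the \<open>\<theta>\<^sub>k\<close>.

  This product is controlled by a potential.  For positive definite \<open>A\<close> and \<open>G\<close> consider
  \<open>tr (A\<^sup>-\<^sup>1 G) + tr (G\<^sup>-\<^sup>1 A)\<close>, which is at least \<open>2 n\<close>.  An update of the Broyden class towards \<open>A = J\<^sub>k\<close> in the
  direction \<open>u\<^sub>k\<close> decreases it by at least a constant times \<open>(\<phi>\<^sub>k / \<eta> + 1 - \<phi>\<^sub>k) \<theta>\<^sub>k\<^sup>2\<close>
  (\<open>potential_broyd_decrease\<close>), as long as \<open>G\<^sub>k\<close> lies between \<open>2/3 J\<^sub>k\<close> and \<open>3/2 \<eta> J\<^sub>k\<close>.  The second trace is
  what makes this hold although \<open>G\<^sub>k\<close> need not dominate \<open>J\<^sub>k\<close>.  Initially the potential is at most a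
  constant times \<open>n \<eta>\<close>, and the change of the Hessian along the path contributes only a bounded factor.
  Therefore the weighted sum of the \<open>\<theta>\<^sub>i\<^sup>2\<close> is at most \<open>(3/2)\<^sup>4 n \<eta>\<close> (\<open>weighted_reduction_sum\<close>), and the
  inequality of arithmetic and geometric means bounds the product of the first \<open>k\<close> of the weighted
  \<open>\<theta>\<^sub>i\<^sup>2\<close> by \<open>((3/2)\<^sup>4 n \<eta> / k)\<^sup>k\<close>.

  It remains to see that the path is short, that is \<open>M \<Sum> r\<^sub>i \<le> ln (3/2)\<close>; this keeps \<open>G\<^sub>k\<close> within the bounds
  required above, because Broyden updates preserve two-sided bounds with respect to \<open>J\<^sub>k\<close>.  The bounds
  give \<open>r\<^sub>k \<le> 3/2 \<lambda>\<^sub>k\<close> and linear convergence with factor \<open>1 - 3/(8 \<eta>)\<close>.  Under the assumption on the starting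
  point both statements are proved together, by the invariant
  \<open>M \<Sum>\<^sub>i\<^sub><\<^sub>k r\<^sub>i + 4 \<eta> M \<lambda>\<^sub>k \<le> ln (3/2)\<close> (\<open>drift_invariant\<close>).
\<close>

section \<open>Positive definite operators and their orthonormal bases\<close>

definition spd :: "'a::real_normed_vector dual_op \<Rightarrow> bool" where
  "spd A \<longleftrightarrow> self_adjoint A \<and> positive_definite A"

lemma spd_sym: "spd A \<Longrightarrow> A x y = A y x"
  by (simp add: spd_def self_adjoint_def)

lemma spd_pos: "spd A \<Longrightarrow> x \<noteq> 0 \<Longrightarrow> A x x > 0"
  by (simp add: spd_def positive_definite_def)

lemma spd_nonneg: "spd A \<Longrightarrow> A x x \<ge> 0"
  by (cases "x = 0") (auto simp: spd_pos less_imp_le)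

lemma op_le_iff: "A \<preceq> A' \<longleftrightarrow> (\<forall>x. A x x \<le> A' x x)"
  by (simp add: op_le_def blinfun.bilinear_simps)

lemma spd_scaleR: "spd A \<Longrightarrow> c > 0 \<Longrightarrow> spd (c *\<^sub>R A)"
  by (simp add: spd_def self_adjoint_def positive_definite_def blinfun.bilinear_simps)

text \<open>
  The discriminant of \<open>t \<mapsto> P (x + t y) (x + t y) \<ge> 0\<close>.  Semidefinite forms are admitted because
  the lemma will be applied to a difference \<open>p G - A\<close>, which may be degenerate.
\<close>

lemma semidefinite_cauchy_schwarz:
  fixes P :: "'a::real_normed_vector dual_op"
  assumes sym: "self_adjoint P" and psd: "\<And>x. P x x \<ge> 0"
  shows "(P x y)\<^sup>2 \<le> P x x * P y y"
proof -
  have q: "0 \<le> P x x + 2 * t * P x y + t\<^sup>2 * P y y" for t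
  proof -
    have "P y x = P x y"
      using sym by (simp add: self_adjoint_def)
    then have "P (x + t *\<^sub>R y) (x + t *\<^sub>R y) = P x x + 2 * t * P x y + t\<^sup>2 * P y y"
      by (simp add: blinfun.bilinear_simps algebra_simps power2_eq_square)
    then show ?thesis
      using psd by metis
  qed
  show ?thesis
  proof (cases "P y y = 0")
    case True
    have "P x y = 0"
    proof (rule ccontr)
      assume "P x y \<noteq> 0"
      with q[of "- (P x x + 1) / (2 * P x y)"] True show False
        by (simp add: field_simps)
    qed
    then show ?thesis
      using True by simp
  next
    case False
    then have p: "P y y > 0"
      using psd[of y] by linarith
    have "0 \<le> P y y * (P x x + 2 * (- P x y / P y y) * P x y + (- P x y / P y y)\<^sup>2 * P y y)"
      using p by (intro mult_nonneg_nonneg q) simp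
    also have "\<dots> = P x x * P y y - (P x y)\<^sup>2"
      using p by (simp add: field_simps power2_eq_square)
    finally show ?thesis
      by simp
  qed
qed

definition orthonormal_wrt :: "'a::real_normed_vector dual_op \<Rightarrow> 'a set \<Rightarrow> bool" where
  "orthonormal_wrt A E \<longleftrightarrow> finite E \<and> (\<forall>x\<in>E. \<forall>y\<in>E. A x y = (if x = y then 1 else 0))"

lemma orthonormal_wrt_sum:
  assumes "orthonormal_wrt A E" "e \<in> E"
  shows "A (\<Sum>v\<in>E. c v *\<^sub>R v) e = c e"
proof -
  have "A (\<Sum>v\<in>E. c v *\<^sub>R v) e = (\<Sum>v\<in>E. c v * A v e)"
    by (simp add: blinfun.bilinear_simps blinfun.sum_left blinfun.sum_right)
  also have "\<dots> = (\<Sum>v\<in>E. if v = e then c v else 0)"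
    using assms by (intro sum.cong) (auto simp: orthonormal_wrt_def)
  also have "\<dots> = c e"
    using assms by (simp add: orthonormal_wrt_def)
  finally show ?thesis .
qed

lemma orthonormal_wrt_independent:
  assumes "orthonormal_wrt A E"
  shows "independent E"
proof (rule independent_if_scalars_zero)
  show "finite E"
    using assms by (simp add: orthonormal_wrt_def)
  fix c x assume "(\<Sum>v\<in>E. c v *\<^sub>R v) = 0" "x \<in> E"
  then show "c x = 0"
    using orthonormal_wrt_sum[OF assms, of x c] by simp
qed

text \<open>
  An orthonormal family of maximal cardinality is a basis: a vector that differs from its expansion
  would, after subtracting the expansion and normalizing, extend the family.
\<close>

lemma orthonormal_basis_wrt_exists:
  fixes A :: "'a::euclidean_space dual_op"
  assumes A: "spd A"
  obtains E where "orthonormal_wrt A E" "card E = DIM('a)" "\<And>x. x = (\<Sum>e\<in>E. A x e *\<^sub>R e)"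
proof -
  have "\<exists>E. orthonormal_wrt A E \<and> (\<forall>F. orthonormal_wrt A F \<longrightarrow> card F \<le> card E)"
  proof (rule ex_has_greatest_nat)
    show "orthonormal_wrt A {}"
      by (simp add: orthonormal_wrt_def)
    show "\<forall>F. orthonormal_wrt A F \<longrightarrow> card F < Suc DIM('a)"
      using orthonormal_wrt_independent independent_bound by (metis less_Suc_eq_le)
  qed
  then obtain E where E: "orthonormal_wrt A E"
    and max: "\<And>F. orthonormal_wrt A F \<Longrightarrow> card F \<le> card E"
    by blast
  then have fin: "finite E"
    by (simp add: orthonormal_wrt_def)
  have expand: "x = (\<Sum>e\<in>E. A x e *\<^sub>R e)" for x
  proof (rule ccontr)
    define y where "y = x - (\<Sum>e\<in>E. A x e *\<^sub>R e)"
    define z where "z = (1 / sqrt (A y y)) *\<^sub>R y"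
    assume "\<not> ?thesis"
    then have "A y y > 0"
      by (intro spd_pos[OF A]) (simp add: y_def)
    then have zz: "A z z = 1"
      by (simp add: z_def blinfun.bilinear_simps)
    have "A y e = 0" if "e \<in> E" for e
      using orthonormal_wrt_sum[OF E that, of "\<lambda>e. A x e"]
      by (simp add: y_def blinfun.bilinear_simps)
    then have ze: "A z e = 0" "A e z = 0" if "e \<in> E" for e
      using that spd_sym[OF A, of e z] by (simp_all add: z_def blinfun.bilinear_simps)
    then have "z \<notin> E"
      using zz by fastforce
    moreover have "orthonormal_wrt A (insert z E)"
      using E ze zz by (auto simp: orthonormal_wrt_def)
    ultimately show False
      using max[of "insert z E"] fin by simp
  qed
  have "x \<in> span E" for x
    by (subst expand[of x]) (intro span_sum span_scale span_base)
  then have "span E = UNIV"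
    by blast
  then have "card E = DIM('a)"
    using orthonormal_wrt_independent[OF E]
    by (metis dim_UNIV dim_eq_card_independent dim_span)
  with E expand show thesis
    using that by blast
qed

definition basis_wrt :: "'a::euclidean_space dual_op \<Rightarrow> 'a set" where
  "basis_wrt A = (SOME E. orthonormal_wrt A E \<and> card E = DIM('a) \<and>
     (\<forall>x. x = (\<Sum>e\<in>E. A x e *\<^sub>R e)))"

context
  fixes A :: "'a::euclidean_space dual_op"
  assumes A: "spd A"
begin

lemma basis_wrt:
  shows orthonormal_basis_wrt: "orthonormal_wrt A (basis_wrt A)"
    and card_basis_wrt: "card (basis_wrt A) = DIM('a)"
    and basis_wrt_expansion: "x = (\<Sum>e\<in>basis_wrt A. A x e *\<^sub>R e)"
proof -
  have "\<exists>E. orthonormal_wrt A E \<and> card E = DIM('a) \<and> (\<forall>x. x = (\<Sum>e\<in>E. A x e *\<^sub>R e))"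
    by (rule orthonormal_basis_wrt_exists[OF A]) blast
  from someI_ex[OF this]
  have *: "orthonormal_wrt A (basis_wrt A) \<and> card (basis_wrt A) = DIM('a) \<and>
     (\<forall>x. x = (\<Sum>e\<in>basis_wrt A. A x e *\<^sub>R e))"
    unfolding basis_wrt_def .
  from * show "orthonormal_wrt A (basis_wrt A)" "card (basis_wrt A) = DIM('a)"
    by auto
  from * show "x = (\<Sum>e\<in>basis_wrt A. A x e *\<^sub>R e)"
    by blast
qed

lemma functional_expansion: "blinfun_apply s x = (\<Sum>e\<in>basis_wrt A. A x e * s e)"
  for s :: "'a dual"
  by (subst basis_wrt_expansion[of x])
    (simp add: blinfun.sum_right blinfun.bilinear_simps)

lemma parseval: "A x y = (\<Sum>e\<in>basis_wrt A. A e x * A e y)"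
  by (subst functional_expansion) (simp add: spd_sym[OF A] mult.commute)

lemma bij_spd: "bij (blinfun_apply A)"
proof (rule bijI)
  show "inj (blinfun_apply A)"
  proof (rule injI)
    fix x y assume "A x = A y"
    then have "A (x - y) (x - y) = 0"
      by (simp add: blinfun.bilinear_simps)
    then show "x = y"
      using spd_pos[OF A, of "x - y"] by force
  qed
  have "A (\<Sum>e\<in>basis_wrt A. s e *\<^sub>R e) = s" for s :: "'a dual"
  proof (rule blinfun_eqI)
    fix x
    show "A (\<Sum>e\<in>basis_wrt A. s e *\<^sub>R e) x = s x"
      by (subst functional_expansion[of s x])
        (simp add: blinfun.bilinear_simps blinfun.sum_left spd_sym[OF A] mult.commute)
  qed
  then show "surj (blinfun_apply A)"
    by (metis surj_def)
qed

lemma op_inv_right [simp]: "A (op_inv A s) = s"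
  using bij_spd by (simp add: op_inv_def bij_is_surj surj_f_inv_f)

lemma op_inv_left [simp]: "op_inv A (A x) = x"
  using bij_spd by (simp add: op_inv_def bij_is_inj)

end

section \<open>Dual norms\<close>

text \<open>
  The square of the norm on the dual space that is dual to \<open>h \<mapsto> (A h h)\<^sup>1\<^sup>/\<^sup>2\<close>, that is
  \<open>\<langle>s, A\<^sup>-\<^sup>1 s\<rangle>\<close>.
\<close>

definition dual_form :: "'a::real_normed_vector dual_op \<Rightarrow> 'a dual \<Rightarrow> real" where
  "dual_form A s = s (op_inv A s)"

lemma newton_decrement_eq: "newton_decrement f x = sqrt (dual_form (hess f x) (grad f x))"
  by (simp add: newton_decrement_def dual_form_def)

lemma dual_form_apply: "spd A \<Longrightarrow> dual_form A (A x) = A x x"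
  for A :: "'a::euclidean_space dual_op"
  by (simp add: dual_form_def)

lemma dual_form_eq: "spd A \<Longrightarrow> dual_form A s = A (op_inv A s) (op_inv A s)"
  for A :: "'a::euclidean_space dual_op"
  by (simp add: dual_form_def)

lemma dual_form_nonneg: "spd A \<Longrightarrow> dual_form A s \<ge> 0"
  for A :: "'a::euclidean_space dual_op"
  by (metis dual_form_eq spd_nonneg)

lemma dual_form_scaleR: "spd A \<Longrightarrow> dual_form A (c *\<^sub>R s) = c\<^sup>2 * dual_form A s"
  for A :: "'a::euclidean_space dual_op"
proof -
  assume A: "spd A"
  have "op_inv A (c *\<^sub>R s) = c *\<^sub>R op_inv A s"
    using op_inv_left[OF A, of "c *\<^sub>R op_inv A s"] A by (simp add: blinfun.bilinear_simps)
  then show ?thesis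
    by (simp add: dual_form_def blinfun.bilinear_simps power2_eq_square)
qed

lemma dual_form_minus: "spd A \<Longrightarrow> dual_form A (- s) = dual_form A s"
  for A :: "'a::euclidean_space dual_op"
  using dual_form_scaleR[of A "-1" s] by simp

lemma dual_form_eq_0_iff: "spd A \<Longrightarrow> dual_form A s = 0 \<longleftrightarrow> s = 0"
  for A :: "'a::euclidean_space dual_op"
  by (metis blinfun.zero_left dual_form_def dual_form_eq less_irrefl op_inv_right spd_pos blinfun.zero_right)

text \<open>
  The dual form is the convex conjugate of the quadratic form: \<open>\<langle>s, A\<^sup>-\<^sup>1 s\<rangle>\<close> is the maximum over \<open>v\<close> of
  \<open>2 \<langle>s, v\<rangle> - \<langle>A v, v\<rangle>\<close>, attained at \<open>A\<^sup>-\<^sup>1 s\<close>.  With this description, bounds on the inverse of an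
  operator follow from bounds on its quadratic form, and no inverse has to be computed.
\<close>

lemma dual_form_sup:
  fixes A :: "'a::euclidean_space dual_op" and s :: "'a dual"
  assumes A: "spd A"
  shows "2 * s v - A v v \<le> dual_form A s"
proof -
  let ?w = "op_inv A s"
  have "0 \<le> A (?w - v) (?w - v)"
    using spd_nonneg[OF A] .
  also have "A (?w - v) (?w - v) = A ?w ?w - 2 * A ?w v + A v v"
    by (simp add: blinfun.bilinear_simps spd_sym[OF A, of v "op_inv A s"] del: op_inv_right)
  finally show ?thesis
    using A by (simp add: dual_form_def)
qed

lemma dual_form_leI:
  fixes A :: "'a::euclidean_space dual_op" and s :: "'a dual"
  assumes A: "spd A" and le: "\<And>v. 2 * s v - A v v \<le> c"
  shows "dual_form A s \<le> c"
  using le[of "op_inv A s"] A by (simp add: dual_form_def)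

lemma dual_form_antimono:
  fixes A A' :: "'a::euclidean_space dual_op" and s :: "'a dual"
  assumes A: "spd A" and A': "spd A'" and c: "c > 0"
    and le: "\<And>v. A v v \<le> c * A' v v"
  shows "dual_form A' s \<le> c * dual_form A s"
proof (rule dual_form_leI[OF A'])
  fix v
  \<comment> \<open>Scaling the test vector by \<open>1/c\<close> balances the linear against the quadratic term.\<close>
  have "2 * s ((1/c) *\<^sub>R v) - A ((1/c) *\<^sub>R v) ((1/c) *\<^sub>R v) \<le> dual_form A s"
    using dual_form_sup[OF A] .
  then have "2 * s v * c - A v v \<le> c\<^sup>2 * dual_form A s"
    using c by (simp add: blinfun.bilinear_simps field_simps power2_eq_square)
  then have "c * (2 * s v - A' v v) \<le> c * (c * dual_form A s)"
    using le[of v] by (simp add: algebra_simps power2_eq_square)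
  then show "2 * s v - A' v v \<le> c * dual_form A s"
    using c by simp
qed

section \<open>Relative traces\<close>

text \<open>
  The trace of \<open>A\<^sup>-\<^sup>1 G\<close>, computed in a basis that is orthonormal for \<open>A\<close>.
\<close>

definition rel_trace :: "'a::euclidean_space dual_op \<Rightarrow> 'a dual_op \<Rightarrow> real" where
  "rel_trace A G = (\<Sum>e\<in>basis_wrt A. G e e)"

lemma rel_trace_add: "rel_trace A (X + Y) = rel_trace A X + rel_trace A Y"
  and rel_trace_diff: "rel_trace A (X - Y) = rel_trace A X - rel_trace A Y"
  and rel_trace_scaleR: "rel_trace A (c *\<^sub>R X) = c * rel_trace A X"
  by (simp_all add: rel_trace_def blinfun.bilinear_simps sum.distrib sum_subtractf sum_distrib_left)

lemma rel_trace_mono: "(\<And>v. X v v \<le> c * Y v v) \<Longrightarrow> rel_trace A X \<le> c * rel_trace A Y"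
  for X Y :: "'a::euclidean_space dual_op"
  by (auto simp: rel_trace_def sum_distrib_left intro!: sum_mono)

lemma rel_trace_self:
  fixes A :: "'a::euclidean_space dual_op"
  assumes A: "spd A"
  shows "rel_trace A A = DIM('a)"
  using basis_wrt(1)[OF A] card_basis_wrt[OF A]
  by (simp add: rel_trace_def orthonormal_wrt_def)

lemma rel_trace_outer:
  assumes A: "spd A"
  shows "rel_trace A (outer s r) = r (op_inv A s)"
  unfolding rel_trace_def functional_expansion[OF A, of r "op_inv A s"]
  by (simp add: outer_apply blinfun.bilinear_simps A mult.commute)

text \<open>
  \<open>G\<close> is the sum of the rank-one operators \<open>G g (G g)\<^sup>*\<close> over a \<open>G\<close>-orthonormal basis.  In this form the
  trace depends on \<open>A\<close> only through its dual form, so that it becomes comparable for different \<open>A\<close>.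
\<close>

lemma rel_trace_eq_dual:
  assumes A: "spd A" and G: "spd G"
  shows "rel_trace A G = (\<Sum>g\<in>basis_wrt G. dual_form A (G g))"
proof -
  have "rel_trace A G = (\<Sum>e\<in>basis_wrt A. \<Sum>g\<in>basis_wrt G. G g e * G g e)"
    unfolding rel_trace_def by (intro sum.cong refl parseval[OF G])
  also have "\<dots> = (\<Sum>g\<in>basis_wrt G. \<Sum>e\<in>basis_wrt A. G g e * G g e)"
    by (rule sum.swap)
  also have "\<dots> = (\<Sum>g\<in>basis_wrt G. rel_trace A (outer (G g) (G g)))"
    by (simp add: rel_trace_def outer_apply blinfun.bilinear_simps)
  also have "\<dots> = (\<Sum>g\<in>basis_wrt G. dual_form A (G g))"
    by (simp add: rel_trace_outer[OF A] dual_form_def)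
  finally show ?thesis .
qed

lemma rel_trace_antimono:
  assumes A: "spd A" and A': "spd A'" and G: "spd G" and c: "c > 0"
    and le: "\<And>v. A v v \<le> c * A' v v"
  shows "rel_trace A' G \<le> c * rel_trace A G"
  unfolding rel_trace_eq_dual[OF A' G] rel_trace_eq_dual[OF A G] sum_distrib_left
  by (intro sum_mono dual_form_antimono[OF A A' c le])

section \<open>Updates of the Broyden class\<close>

lemma broyd_apply:
  fixes A G :: "'a::euclidean_space dual_op"
  assumes u: "u \<noteq> 0"
  shows "broyd \<phi> A G u v w =
     \<phi> * (G v w - (A u w * G u v + G u w * A u v) / A u u
           + (G u u / A u u + 1) * (A u v * A u w / A u u))
     + (1 - \<phi>) * (G v w - G u v * G u w / G u u + A u v * A u w / A u u)"
  using u by (simp add: broyd_def outer_apply blinfun.bilinear_simps algebra_simps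
      add_divide_distrib diff_divide_distrib)

lemma quadratic_project:
  fixes X :: "'a::euclidean_space dual_op"
  assumes "spd X"
  shows "X (v - t *\<^sub>R u) (v - t *\<^sub>R u) = X v v - 2 * t * X u v + t\<^sup>2 * X u u"
  using spd_sym[OF assms, of v u]
  by (simp add: blinfun.bilinear_simps algebra_simps power2_eq_square)

lemma dual_form_project:
  fixes G :: "'a::euclidean_space dual_op" and s r :: "'a dual"
  assumes G: "spd G"
  shows "dual_form G (s - t *\<^sub>R r) = dual_form G s - 2 * t * r (op_inv G s) + t\<^sup>2 * dual_form G r"
proof -
  let ?x = "op_inv G s" and ?y = "op_inv G r"
  have "s - t *\<^sub>R r = G (?x - t *\<^sub>R ?y)"
    using G by (simp add: blinfun.bilinear_simps)
  then have "dual_form G (s - t *\<^sub>R r) = G (?x - t *\<^sub>R ?y) (?x - t *\<^sub>R ?y)"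
    by (simp only: dual_form_apply[OF G])
  also have "\<dots> = G ?x ?x - 2 * t * G ?y ?x + t\<^sup>2 * G ?y ?y"
    by (rule quadratic_project[OF G])
  finally show ?thesis
    using G by (simp add: dual_form_def)
qed

context
  fixes A G :: "'a::euclidean_space dual_op" and u :: 'a and \<phi> :: real
  assumes A: "spd A" and G: "spd G" and u: "u \<noteq> 0" and phi: "0 \<le> \<phi>" "\<phi> \<le> 1"
begin

abbreviation "bfgs_dir v \<equiv> v - (G u v / G u u) *\<^sub>R u"
abbreviation "dfp_dir v \<equiv> v - (A u v / A u u) *\<^sub>R u"

lemma Auu_pos: "A u u > 0" and Guu_pos: "G u u > 0"
  using spd_pos A G u by auto

lemma bfgs_dir_value: "G (bfgs_dir v) (bfgs_dir v) = G v v - (G u v)\<^sup>2 / G u u"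
  using Guu_pos by (simp add: quadratic_project[OF G] power2_eq_square field_simps)

lemma dfp_dir_value: "G (dfp_dir v) (dfp_dir v)
    = G v v - 2 * A u v * G u v / A u u + G u u * (A u v)\<^sup>2 / (A u u)\<^sup>2"
  using Auu_pos by (simp add: quadratic_project[OF G] power2_eq_square field_simps)

lemma projection_minimal:
  assumes X: "spd X"
  shows "X v v - (X u v)\<^sup>2 / X u u \<le> X (v - t *\<^sub>R u) (v - t *\<^sub>R u)"
proof -
  have p: "X u u > 0"
    using spd_pos[OF X] u by auto
  have "0 \<le> (t * X u u - X u v)\<^sup>2 / X u u"
    using p by simp
  also have "\<dots> = X (v - t *\<^sub>R u) (v - t *\<^sub>R u) - (X v v - (X u v)\<^sup>2 / X u u)"
    using p by (simp add: quadratic_project[OF X] field_simps power2_eq_square)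
  finally show ?thesis
    by simp
qed

text \<open>
  The BFGS and DFP updates both replace the part of \<open>G\<close> along \<open>u\<close> by \<open>A u u\<^sup>* A / \<langle>A u, u\<rangle>\<close>.  What remains of
  \<open>G\<close> is its restriction to a complement of \<open>u\<close>: BFGS projects \<open>v\<close> along \<open>u\<close> orthogonally with respect to
  \<open>G\<close>, DFP with respect to \<open>A\<close>.
\<close>

lemma broyd_eq_mixture:
  "broyd \<phi> A G u v v = \<phi> * G (dfp_dir v) (dfp_dir v)
     + (1 - \<phi>) * G (bfgs_dir v) (bfgs_dir v) + (A u v)\<^sup>2 / A u u"
  unfolding broyd_apply[OF u] dfp_dir_value bfgs_dir_value
  using Auu_pos Guu_pos by (simp add: field_simps power2_eq_square)

text \<open>
  Orthogonal projection minimizes, so among the updates of the Broyden class BFGS is the smallest and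
  DFP the largest.
\<close>

lemma broyd_ge: "broyd \<phi> A G u v v \<ge> G (bfgs_dir v) (bfgs_dir v) + (A u v)\<^sup>2 / A u u"
proof -
  have "G (bfgs_dir v) (bfgs_dir v) \<le> G (dfp_dir v) (dfp_dir v)"
    unfolding bfgs_dir_value by (rule projection_minimal[OF G])
  then have "\<phi> * G (bfgs_dir v) (bfgs_dir v) \<le> \<phi> * G (dfp_dir v) (dfp_dir v)"
    using phi by (intro mult_left_mono)
  then show ?thesis
    unfolding broyd_eq_mixture by (simp add: algebra_simps)
qed

lemma broyd_le: "broyd \<phi> A G u v v \<le> G (dfp_dir v) (dfp_dir v) + (A u v)\<^sup>2 / A u u"
proof -
  have "G (bfgs_dir v) (bfgs_dir v) \<le> G (dfp_dir v) (dfp_dir v)"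
    unfolding bfgs_dir_value by (rule projection_minimal[OF G])
  then have "(1 - \<phi>) * G (bfgs_dir v) (bfgs_dir v) \<le> (1 - \<phi>) * G (dfp_dir v) (dfp_dir v)"
    using phi by (intro mult_left_mono) auto
  then show ?thesis
    unfolding broyd_eq_mixture by (simp add: algebra_simps)
qed

text \<open>
  For the lower bound BFGS is the extreme case.  The value \<open>A v v\<close> is at most the value at any projection of
  \<open>v\<close> along \<open>u\<close> plus \<open>(A u v)\<^sup>2 / A u u\<close>.  Only the first summand has to be compared with \<open>G\<close>; the second one
  occurs in the update itself, and multiplying it by \<open>\<xi> \<ge> 1\<close> enlarges it.
\<close>

lemma broyd_lower_nonzero:
  assumes xi: "\<xi> \<ge> 1" and le: "\<And>v. A v v \<le> \<xi> * G v v"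
  shows "A v v \<le> \<xi> * broyd \<phi> A G u v v"
proof -
  have "A v v \<le> A (bfgs_dir v) (bfgs_dir v) + (A u v)\<^sup>2 / A u u"
    using projection_minimal[OF A, of v "G u v / G u u"] by simp
  also have "\<dots> \<le> \<xi> * G (bfgs_dir v) (bfgs_dir v) + \<xi> * ((A u v)\<^sup>2 / A u u)"
    using le xi Auu_pos mult_right_mono[of 1 \<xi> "(A u v)\<^sup>2 / A u u"] by (intro add_mono) auto
  also have "\<dots> \<le> \<xi> * broyd \<phi> A G u v v"
    using mult_left_mono[OF broyd_ge[of v], of \<xi>] xi by (simp add: distrib_left)
  finally show ?thesis .
qed

text \<open>
  For the upper bound DFP is the extreme case; its projection is \<open>A\<close>-orthogonal, so that the two terms
  recombine to \<open>A v v\<close> by Pythagoras.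
\<close>

lemma broyd_upper_nonzero:
  assumes eta: "\<eta> \<ge> 1" and le: "\<And>v. G v v \<le> \<eta> * A v v"
  shows "broyd \<phi> A G u v v \<le> \<eta> * A v v"
proof -
  have "broyd \<phi> A G u v v \<le> G (dfp_dir v) (dfp_dir v) + (A u v)\<^sup>2 / A u u"
    by (rule broyd_le)
  also have "\<dots> \<le> \<eta> * A (dfp_dir v) (dfp_dir v) + \<eta> * ((A u v)\<^sup>2 / A u u)"
    using le eta Auu_pos mult_right_mono[of 1 \<eta> "(A u v)\<^sup>2 / A u u"] by (intro add_mono) auto
  also have "\<dots> = \<eta> * A v v"
    using Auu_pos by (simp add: quadratic_project[OF A] field_simps power2_eq_square)
  finally show ?thesis .
qed

lemma spd_broyd_nonzero: "spd (broyd \<phi> A G u)"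
proof -
  have "broyd \<phi> A G u v w = broyd \<phi> A G u w v" for v w
    using spd_sym[OF G, of v w] by (simp add: broyd_apply[OF u] algebra_simps)
  moreover have "broyd \<phi> A G u v v > 0" if v: "v \<noteq> 0" for v
  proof (cases "bfgs_dir v = 0")
    case True
    then have "v = (G u v / G u u) *\<^sub>R u"
      by simp
    then have "A u v \<noteq> 0"
      using v Auu_pos by (metis blinfun.scaleR_right less_irrefl mult_eq_0_iff real_scaleR_def scaleR_eq_0_iff)
    then have "(A u v)\<^sup>2 / A u u > 0"
      using Auu_pos by simp
    then show ?thesis
      using broyd_ge[of v] spd_nonneg[OF G, of "bfgs_dir v"] by linarith
  next
    case False
    then have "G (bfgs_dir v) (bfgs_dir v) > 0"
      by (rule spd_pos[OF G])
    moreover have "(A u v)\<^sup>2 / A u u \<ge> 0"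
      using Auu_pos by simp
    ultimately show ?thesis
      using broyd_ge[of v] by linarith
  qed
  ultimately show ?thesis
    by (auto simp: spd_def self_adjoint_def positive_definite_def)
qed

lemma rel_trace_broyd:
  "rel_trace A (broyd \<phi> A G u) = rel_trace A G
     - (\<phi> * (G u u / A u u) + (1 - \<phi>) * (dual_form A (G u) / G u u)) + 1"
proof -
  have AG: "G u (op_inv A (A u)) = G u u"
    and GA: "A u (op_inv A (G u)) = G u u"
    and AA: "A u (op_inv A (A u)) = A u u"
    using A by (simp_all add: spd_sym[OF A, of u "op_inv A (G u)"])
  show ?thesis
    using u Auu_pos Guu_pos
    by (simp add: broyd_def rel_trace_add rel_trace_diff rel_trace_scaleR rel_trace_outer[OF A]
        dual_form_def[symmetric] AG GA AA dual_form_apply[OF A]) (simp add: field_simps)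
qed

text \<open>
  The right-hand side is the value of \<open>s\<close> under the inverse of the BFGS update.  Since BFGS is the
  smallest update, its inverse dominates the inverse of every update of the class.  The functional is
  split as \<open>s = r + (s u / A u u) A u\<close> with \<open>r u = 0\<close>; the two parts are then maximized separately.
\<close>

lemma dual_form_broyd_le:
  "dual_form (broyd \<phi> A G u) s
    \<le> dual_form G (s - (s u / A u u) *\<^sub>R A u) + (s u)\<^sup>2 / A u u"
proof (rule dual_form_leI[OF spd_broyd_nonzero])
  fix v
  define r where "r = s - (s u / A u u) *\<^sub>R A u"
  have "r u = 0"
    using Auu_pos by (simp add: r_def blinfun.bilinear_simps)
  then have "2 * r v - G (bfgs_dir v) (bfgs_dir v) \<le> dual_form G r"
    using dual_form_sup[OF G, of r "bfgs_dir v"] by (simp add: blinfun.bilinear_simps)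
  moreover have "2 * (s u / A u u) * A u v - (A u v)\<^sup>2 / A u u \<le> (s u)\<^sup>2 / A u u"
  proof -
    have "0 \<le> (s u - A u v)\<^sup>2 / A u u"
      using Auu_pos by simp
    also have "\<dots> = (s u)\<^sup>2 / A u u - 2 * (s u / A u u) * A u v + (A u v)\<^sup>2 / A u u"
      using Auu_pos by (simp add: field_simps power2_eq_square)
    finally show ?thesis
      by linarith
  qed
  moreover have "s v = r v + (s u / A u u) * A u v"
    by (simp add: r_def blinfun.bilinear_simps)
  ultimately have "2 * s v - (G (bfgs_dir v) (bfgs_dir v) + (A u v)\<^sup>2 / A u u)
      \<le> dual_form G r + (s u)\<^sup>2 / A u u"
    by (simp add: algebra_simps)
  then show "2 * s v - broyd \<phi> A G u v v \<le> dual_form G r + (s u)\<^sup>2 / A u u"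
    using broyd_ge[of v] by linarith
qed

text \<open>
  The previous bound is summed over \<open>s = A e\<close> for \<open>e\<close> in an \<open>A\<close>-orthonormal basis.  By Parseval's identity the
  corrections add up to \<open>- 2 d/a + d/a + 1\<close> with \<open>a = A u u\<close> and \<open>d = \<langle>A u, G\<^sup>-\<^sup>1 A u\<rangle>\<close>.
\<close>

lemma rel_trace_broyd_reverse:
  "rel_trace (broyd \<phi> A G u) A \<le> rel_trace G A - dual_form G (A u) / A u u + 1"
proof -
  let ?E = "basis_wrt A" and ?w = "op_inv G (A u)" and ?d = "dual_form G (A u)"
  define a where "a = A u u"
  have a: "a > 0"
    using Auu_pos by (simp add: a_def)
  have A_Gw: "A u (op_inv G (A e)) = A e ?w" for e
    using spd_sym[OF G, of ?w "op_inv G (A e)"] G by simp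
  have "rel_trace (broyd \<phi> A G u) A = (\<Sum>e\<in>?E. dual_form (broyd \<phi> A G u) (A e))"
    by (rule rel_trace_eq_dual[OF spd_broyd_nonzero A])
  also have "\<dots> \<le> (\<Sum>e\<in>?E. dual_form G (A e) - 2 * (A e u / a) * A e ?w
      + (A e u / a)\<^sup>2 * ?d + (A e u)\<^sup>2 / a)"
  proof (rule sum_mono)
    fix e
    show "dual_form (broyd \<phi> A G u) (A e) \<le> dual_form G (A e) - 2 * (A e u / a) * A e ?w
      + (A e u / a)\<^sup>2 * ?d + (A e u)\<^sup>2 / a"
      using dual_form_broyd_le[of "A e"] unfolding dual_form_project[OF G] A_Gw a_def[symmetric] .
  qed
  also have "\<dots> = (\<Sum>e\<in>?E. dual_form G (A e)) - 2 / a * (\<Sum>e\<in>?E. A e u * A e ?w)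
      + ?d / a\<^sup>2 * (\<Sum>e\<in>?E. A e u * A e u) + (\<Sum>e\<in>?E. A e u * A e u) / a"
    by (simp add: sum.distrib sum_subtractf sum_distrib_left sum_divide_distrib
        power2_eq_square algebra_simps)
  also have "\<dots> = rel_trace G A - 2 / a * ?d + ?d / a\<^sup>2 * a + 1"
    using a by (simp add: parseval[OF A, symmetric] rel_trace_eq_dual[OF G A] dual_form_def
        a_def[symmetric])
  also have "\<dots> = rel_trace G A - ?d / a + 1"
    using a by (simp add: field_simps power2_eq_square)
  finally show ?thesis
    by (simp add: a_def)
qed

end

section \<open>Potential and residual of an update\<close>

lemma dual_form_residual:
  fixes A G :: "'a::euclidean_space dual_op"
  assumes A: "spd A" and G: "spd G"
  shows "dual_form A (G u - A u) = dual_form A (G u) - 2 * G u u + A u u"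
    and "dual_form G (G u - A u) = G u u - 2 * A u u + dual_form G (A u)"
proof -
  have "A u (op_inv A (G u)) = G u u"
    using spd_sym[OF A, of u "op_inv A (G u)"] A by simp
  then show "dual_form A (G u - A u) = dual_form A (G u) - 2 * G u u + A u u"
    using dual_form_project[OF A, of "G u" 1 "A u"] by (simp add: dual_form_apply[OF A])
  show "dual_form G (G u - A u) = G u u - 2 * A u u + dual_form G (A u)"
    using dual_form_project[OF G, of "G u" 1 "A u"] G by (simp add: dual_form_apply[OF G])
qed

lemma dual_form_ratio:
  fixes A G :: "'a::euclidean_space dual_op"
  assumes A: "spd A" and u: "u \<noteq> 0"
  shows "(G u u)\<^sup>2 / A u u \<le> dual_form A (G u)"
proof -
  have "A u u > 0"
    using spd_pos A u by auto
  then show ?thesis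
    using dual_form_sup[OF A, of "G u" "(G u u / A u u) *\<^sub>R u"]
    by (simp add: blinfun.bilinear_simps field_simps power2_eq_square)
qed

text \<open>
  In a basis of common eigenvectors this is the sum of \<open>\<lambda> + 1/\<lambda>\<close> over the eigenvalues \<open>\<lambda>\<close> of \<open>A\<^sup>-\<^sup>1 G\<close>.  The
  first trace alone is not monotone under the updates, since it increases when an eigenvalue below 1
  is corrected; the second trace compensates for this increase.
\<close>

definition potential :: "'a::euclidean_space dual_op \<Rightarrow> 'a dual_op \<Rightarrow> real" where
  "potential A G = rel_trace A G + rel_trace G A"

lemma potential_ge:
  fixes A G :: "'a::euclidean_space dual_op"
  assumes A: "spd A" and G: "spd G"
  shows "2 * real DIM('a) \<le> potential A G"
proof -
  let ?E = "basis_wrt A"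
  have E: "A e e = 1" if "e \<in> ?E" for e
    using orthonormal_basis_wrt[OF A] that by (simp add: orthonormal_wrt_def)
  have "2 * real DIM('a) = (\<Sum>e\<in>?E. 2 * A e e)"
    using E by (simp add: card_basis_wrt[OF A])
  also have "\<dots> \<le> (\<Sum>e\<in>?E. G e e + dual_form G (A e))"
    using dual_form_sup[OF G] by (intro sum_mono) (smt (verit))
  also have "\<dots> = potential A G"
    by (simp add: potential_def rel_trace_eq_dual[OF G A] rel_trace_def[of A] sum.distrib)
  finally show ?thesis .
qed

lemma potential_drift:
  fixes A A' G :: "'a::euclidean_space dual_op"
  assumes "spd A" "spd A'" "spd G" and c: "c > 0"
    and le: "\<And>v. A v v \<le> c * A' v v" and le': "\<And>v. A' v v \<le> c * A v v"
  shows "potential A' G \<le> c * potential A G"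
  using rel_trace_antimono[OF assms(1-5)] rel_trace_mono[OF le', of G]
  by (simp add: potential_def distrib_left)

text \<open>
  With \<open>a = \<langle>A u, u\<rangle>\<close>, \<open>b = \<langle>G u, u\<rangle>\<close>, \<open>c = \<langle>G u, A\<^sup>-\<^sup>1 G u\<rangle>\<close> and \<open>d = \<langle>A u, G\<^sup>-\<^sup>1 A u\<rangle>\<close> the potential drops by at
  least \<open>c/b + d/a - 2\<close> for BFGS and by at least \<open>b/a + d/a - 2\<close> for DFP, and in between by the convex
  combination.  For BFGS, \<open>d/a \<ge> a/b\<close> turns the drop into \<open>(c - 2 b + a) / b\<close>, whose numerator is exactly
  the squared dual norm of the residual \<open>G u - A u\<close> with respect to \<open>A\<close>.  For DFP the numerator
  \<open>b - 2 a + d\<close> is the squared dual norm of the same residual with respect to \<open>G\<close>; passing to \<open>A\<close> costs the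
  condition number \<open>\<eta>\<close>.  The powers of \<open>\<xi>\<close> come
  from \<open>G \<preceq> \<xi> \<eta> A\<close>, \<open>b \<le> \<xi> c\<close> and \<open>a \<le> \<xi>\<^sup>2 c\<close>.
\<close>

lemma potential_broyd_decrease:
  fixes A G :: "'a::euclidean_space dual_op"
  assumes A: "spd A" and G: "spd G" and phi: "0 \<le> \<phi>" "\<phi> \<le> 1"
    and xi: "\<xi> \<ge> 1" and eta: "\<eta> \<ge> 1"
    and lower: "\<And>v. A v v \<le> \<xi> * G v v" and upper: "\<And>v. G v v \<le> \<xi> * \<eta> * A v v"
  shows "potential A (broyd \<phi> A G u)
      + (\<phi> / \<eta> + 1 - \<phi>) * (dual_form A (G u - A u) / dual_form A (G u)) / \<xi> ^ 3
    \<le> potential A G"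
proof (cases "u = 0")
  case True
  then show ?thesis
    by (simp add: broyd_def dual_form_def)
next
  case u: False
  define a b c d where "a = A u u" and "b = G u u" and "c = dual_form A (G u)"
    and "d = dual_form G (A u)"
  have pos: "a > 0" "b > 0"
    using spd_pos A G u by (auto simp: a_def b_def)
  have bc: "b\<^sup>2 / a \<le> c" and ad: "a\<^sup>2 / b \<le> d"
    using dual_form_ratio[OF A u, of G] dual_form_ratio[OF G u, of A]
    by (simp_all add: a_def b_def c_def d_def)
  have ab: "a \<le> \<xi> * b"
    using lower by (simp add: a_def b_def)
  have "b * a \<le> b * (\<xi> * b)"
    using ab pos by (intro mult_left_mono) auto
  also have "\<dots> = \<xi> * (b\<^sup>2 / a) * a"
    using pos by (simp add: power2_eq_square)
  also have "\<dots> \<le> \<xi> * c * a"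
    using bc pos xi by (intro mult_right_mono mult_left_mono) auto
  finally have b_le: "b \<le> \<xi> * c"
    using pos by simp
  with pos xi have c: "c > 0"
    by (smt (verit) mult_nonneg_nonpos)
  define q where "q = c - 2 * b + a"
  have q: "dual_form A (G u - A u) = q"
    using dual_form_residual(1)[OF A G, of u] by (simp add: q_def a_def b_def c_def)
  have q0: "q \<ge> 0"
    using dual_form_nonneg[OF A, of "G u - A u"] q by simp
  have "q \<le> (\<xi> * \<eta>) * dual_form G (G u - A u)"
    unfolding q[symmetric] using xi eta upper by (intro dual_form_antimono[OF G A]) auto
  then have qd: "q \<le> \<xi> * \<eta> * (b - 2 * a + d)"
    using dual_form_residual(2)[OF A G, of u] by (simp add: a_def b_def d_def)
  have "a \<le> \<xi> * (\<xi> * c)"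
    using ab b_le xi by (meson mult_left_mono order_trans zero_le_one)
  then have a_le: "a \<le> \<xi>\<^sup>2 * c"
    by (simp add: power2_eq_square)
  have dfp: "q / c / (\<eta> * \<xi> ^ 3) \<le> b / a + d / a - 2"
  proof -
    have "q / c / (\<eta> * \<xi> ^ 3) = q / (\<xi> * \<eta> * (\<xi>\<^sup>2 * c))"
      by (simp add: power2_eq_square power3_eq_cube mult.commute mult.left_commute)
    also have "\<dots> \<le> q / (\<xi> * \<eta> * a)"
      using a_le pos xi eta q0 c by (intro divide_left_mono mult_left_mono) auto
    also have "\<dots> \<le> (\<xi> * \<eta> * (b - 2 * a + d)) / (\<xi> * \<eta> * a)"
      using qd pos xi eta by (intro divide_right_mono) auto
    also have "\<dots> = b / a + d / a - 2"
      using pos xi eta by (simp add: field_simps)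
    finally show ?thesis .
  qed
  have bfgs: "q / c / \<xi> ^ 3 \<le> c / b + d / a - 2"
  proof -
    have "\<xi> ^ 1 \<le> \<xi> ^ 3"
      using xi by (intro power_increasing) auto
    then have "\<xi> * c \<le> \<xi> ^ 3 * c"
      using c by (intro mult_right_mono) auto
    then have "b \<le> \<xi> ^ 3 * c"
      using b_le by linarith
    then have "q / c / \<xi> ^ 3 \<le> q / b"
      using pos q0 c xi divide_left_mono[of b "c * \<xi> ^ 3" q] by (simp add: mult.commute)
    also have "\<dots> = c / b + a / b - 2"
      using pos by (simp add: q_def field_simps)
    also have "a / b = (a\<^sup>2 / b) / a"
      using pos by (simp add: power2_eq_square)
    also have "\<dots> \<le> d / a"
      using ad pos by (intro divide_right_mono) auto
    finally show ?thesis
      by simp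
  qed
  have "\<phi> * (q / c / (\<eta> * \<xi> ^ 3)) + (1 - \<phi>) * (q / c / \<xi> ^ 3)
      \<le> \<phi> * (b / a + d / a - 2) + (1 - \<phi>) * (c / b + d / a - 2)"
    using dfp bfgs phi by (intro add_mono mult_left_mono) auto
  also have "\<dots> = \<phi> * (b / a) + (1 - \<phi>) * (c / b) + d / a - 2"
    by (simp add: algebra_simps diff_divide_distrib)
  finally have "\<phi> * (q / c / (\<eta> * \<xi> ^ 3)) + (1 - \<phi>) * (q / c / \<xi> ^ 3)
      \<le> \<phi> * (b / a) + (1 - \<phi>) * (c / b) + d / a - 2" .
  moreover have "(\<phi> / \<eta> + 1 - \<phi>) * (q / c) / \<xi> ^ 3
      = \<phi> * (q / c / (\<eta> * \<xi> ^ 3)) + (1 - \<phi>) * (q / c / \<xi> ^ 3)"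
    by (simp add: algebra_simps add_divide_distrib diff_divide_distrib)
  ultimately show ?thesis
    using rel_trace_broyd[OF A G u phi] rel_trace_broyd_reverse[OF A G u phi]
    unfolding q potential_def by (simp add: a_def b_def c_def d_def)
qed

text \<open>
  The spectrum of \<open>G\<^sup>-\<^sup>1 A\<close> lies in \<open>[q, p]\<close>, so \<open>I - A G\<^sup>-\<^sup>1\<close> has norm at most \<open>max (1 - q) (p - 1) = 1 - q\<close>.
  Instead of diagonalizing, the proof uses that \<open>(p G - A) A\<^sup>-\<^sup>1 (A - q G)\<close> is positive semidefinite, which
  follows from the Cauchy-Schwarz inequality for the form \<open>P = p G - A\<close> and from \<open>P \<preceq> (p/q - 1) A\<close>.
\<close>

lemma dual_form_residual_le:
  fixes A G :: "'a::euclidean_space dual_op"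
  assumes A: "spd A" and G: "spd G" and p: "p \<ge> 1" and q: "q > 0" and pq: "p + q \<le> 2"
    and lower: "\<And>v. A v v \<le> p * G v v" and upper: "\<And>v. q * G v v \<le> A v v"
  shows "dual_form A (G u - A u) \<le> (1 - q)\<^sup>2 * dual_form A (G u)"
proof -
  define a b c where "a = A u u" and "b = G u u" and "c = dual_form A (G u)"
  define P where "P = p *\<^sub>R G - A"
  define \<delta> where "\<delta> = p / q - 1"
  have P: "self_adjoint P" "\<And>v. P v v \<ge> 0"
    using spd_sym[OF A] spd_sym[OF G] lower
    by (auto simp: P_def self_adjoint_def blinfun.bilinear_simps)
  have P_le: "P v v \<le> \<delta> * A v v" for v
  proof -
    have "p / q * (q * G v v) \<le> p / q * A v v"
      using p q upper by (intro mult_left_mono) auto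
    then show ?thesis
      using q by (simp add: P_def \<delta>_def blinfun.bilinear_simps algebra_simps)
  qed
  define w where "w = op_inv A (P u)"
  have Aw: "A w = P u"
    using A by (simp add: w_def)
  have dP: "dual_form A (P u) = p\<^sup>2 * c - 2 * p * b + a"
  proof -
    have "dual_form A (P u) = dual_form A (A u - p *\<^sub>R G u)"
      using dual_form_minus[OF A, of "P u"] by (simp add: P_def blinfun.bilinear_simps)
    also have "\<dots> = p\<^sup>2 * c - 2 * p * b + a"
      using dual_form_project[OF A, of "A u" p "G u"] A
      by (simp add: a_def b_def c_def dual_form_apply)
    finally show ?thesis .
  qed
  have "dual_form A (P u) \<le> \<delta> * P u u"
  proof (cases "P u = 0")
    case True
    then have "dual_form A (P u) = 0"
      by (simp add: dual_form_def)
    then show ?thesis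
      using True by simp
  next
    case False
    have X: "dual_form A (P u) = A w w" "dual_form A (P u) = P u w"
      using dual_form_eq[OF A, of "P u"] by (simp_all add: dual_form_def w_def)
    have "w \<noteq> 0"
      using False Aw by auto
    then have "A w w > 0"
      by (rule spd_pos[OF A])
    have "(P u w)\<^sup>2 \<le> P u u * P w w"
      by (rule semidefinite_cauchy_schwarz[OF P])
    also have "\<dots> \<le> P u u * (\<delta> * A w w)"
      using P_le P by (intro mult_left_mono) auto
    finally have "A w w * A w w \<le> (\<delta> * P u u) * A w w"
      using X by (simp add: power2_eq_square algebra_simps)
    then show ?thesis
      using X \<open>A w w > 0\<close> by simp
  qed
  then have "p\<^sup>2 * c - 2 * p * b + a \<le> \<delta> * (p * b - a)"
    unfolding dP by (simp add: P_def blinfun.bilinear_simps a_def b_def)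
  then have "q * (p\<^sup>2 * c - 2 * p * b + a) \<le> q * (\<delta> * (p * b - a))"
    using q by simp
  also have "\<dots> = (p - q) * (p * b - a)"
    using q by (simp add: \<delta>_def field_simps)
  finally have "p * (p * q * c - (p + q) * b + a) \<le> 0"
    by (simp add: algebra_simps power2_eq_square)
  then have a_le: "a \<le> (p + q) * b - p * q * c"
    using p by (simp add: mult_le_0_iff)
  have "dual_form A (G u) \<le> 1 / q * dual_form G (G u)"
    using q upper by (intro dual_form_antimono[OF G A]) (auto simp: field_simps)
  then have "q * c \<le> b"
    using q by (simp add: dual_form_apply[OF G] b_def c_def field_simps)
  then have "0 \<le> (2 - p - q) * (b - q * c)"
    using pq by (intro mult_nonneg_nonneg) auto
  then have "c - 2 * b + a \<le> (1 - q)\<^sup>2 * c"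
    using a_le by (simp add: algebra_simps power2_eq_square)
  then show ?thesis
    using dual_form_residual(1)[OF A G, of u] by (simp add: a_def b_def c_def)
qed

lemma spd_broyd:
  fixes A G :: "'a::euclidean_space dual_op"
  assumes "spd A" "spd G" "0 \<le> \<phi>" "\<phi> \<le> 1"
  shows "spd (broyd \<phi> A G u)"
  using spd_broyd_nonzero[OF assms(1,2) _ assms(3,4)] assms by (cases "u = 0") (auto simp: broyd_def)

lemma broyd_lower:
  fixes A G :: "'a::euclidean_space dual_op"
  assumes "spd A" "spd G" "0 \<le> \<phi>" "\<phi> \<le> 1" "\<xi> \<ge> 1" "\<And>v. A v v \<le> \<xi> * G v v"
  shows "A v v \<le> \<xi> * broyd \<phi> A G u v v"
  using broyd_lower_nonzero[OF assms(1,2) _ assms(3-6)] assms by (cases "u = 0") (auto simp: broyd_def)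

lemma broyd_upper:
  fixes A G :: "'a::euclidean_space dual_op"
  assumes "spd A" "spd G" "0 \<le> \<phi>" "\<phi> \<le> 1" "\<eta> \<ge> 1" "\<And>v. G v v \<le> \<eta> * A v v"
  shows "broyd \<phi> A G u v v \<le> \<eta> * A v v"
  using broyd_upper_nonzero[OF assms(1,2) _ assms(3-6)] assms by (cases "u = 0") (auto simp: broyd_def)

section \<open>Symmetry of the Hessian\<close>

lemma blinfun_deriv_has_derivative:
  "f differentiable (at x) \<Longrightarrow> (f has_derivative blinfun_apply (blinfun_deriv f x)) (at x)"
  using frechet_derivative_works[of f "at x"]
  by (simp add: blinfun_deriv_def bounded_linear_Blinfun_apply has_derivative_bounded_linear)

text \<open>
  The mean value theorem applied to \<open>s \<mapsto> f (x + t u + s v) - f (x + s v)\<close> expresses the second difference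
  by gradients, which are expanded at \<open>x\<close>.  The second difference is symmetric in \<open>u\<close> and \<open>v\<close> while its limit
  is \<open>H u v\<close>; hence the Hessian is symmetric without any continuity assumption.
\<close>

lemma second_difference_bound:
  fixes f :: "'a::real_normed_vector \<Rightarrow> real" and g :: "'a \<Rightarrow> 'a dual" and H :: "'a dual_op"
  assumes f: "\<And>y. (f has_derivative blinfun_apply (g y)) (at y)"
    and g: "(g has_derivative blinfun_apply H) (at x)" and \<epsilon>: "\<epsilon> > 0"
  obtains \<delta> where "\<delta> > 0" "\<And>t. 0 < t \<Longrightarrow> t < \<delta> \<Longrightarrow>
    \<bar>f (x + t *\<^sub>R u + t *\<^sub>R v) - f (x + t *\<^sub>R u) - f (x + t *\<^sub>R v) + f x - t\<^sup>2 * H u v\<bar> \<le> \<epsilon> * t\<^sup>2"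
proof -
  define N where "N = norm u + norm v"
  \<comment> \<open>The bound produced below is \<open>2 e N \<parallel>v\<parallel> t\<^sup>2\<close>; the summand 1 keeps the denominator positive.\<close>
  define e where "e = \<epsilon> / (2 * N * norm v + 1)"
  have N: "N \<ge> 0" and D: "2 * N * norm v + 1 > 0"
    by (auto simp: N_def intro!: add_nonneg_pos mult_nonneg_nonneg)
  have e: "e > 0" and e_le: "2 * e * N * norm v \<le> \<epsilon>"
    using \<epsilon> D by (auto simp: e_def field_simps)
  obtain d where d: "d > 0"
    and rem: "\<And>y. norm (y - x) < d \<Longrightarrow> norm (g y - g x - H (y - x)) \<le> e * norm (y - x)"
    using g e unfolding has_derivative_at_alt by blast
  have "\<bar>f (x + t *\<^sub>R u + t *\<^sub>R v) - f (x + t *\<^sub>R u) - f (x + t *\<^sub>R v) + f x - t\<^sup>2 * H u v\<bar> \<le> \<epsilon> * t\<^sup>2"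
    if t: "0 < t" "t < d / (N + 1)" for t
  proof -
    define p where "p s = f (x + t *\<^sub>R u + s *\<^sub>R v) - f (x + s *\<^sub>R v)" for s
    have p: "(p has_derivative (\<lambda>h. g (x + t *\<^sub>R u + s *\<^sub>R v) (h *\<^sub>R v) - g (x + s *\<^sub>R v) (h *\<^sub>R v))) (at s within {0..t})" for s
    proof -
      have "((\<lambda>s. f (y + s *\<^sub>R v)) has_derivative (\<lambda>h. g (y + s *\<^sub>R v) (h *\<^sub>R v))) (at s within {0..t})" for y
        by (rule has_derivative_compose[OF _ f]) (auto intro!: derivative_eq_intros)
      then show ?thesis
        unfolding p_def by (intro has_derivative_diff)
    qed
    obtain s where s: "s \<in> {0..t}"
      and ps: "p t - p 0 = g (x + t *\<^sub>R u + s *\<^sub>R v) ((t - 0) *\<^sub>R v) - g (x + s *\<^sub>R v) ((t - 0) *\<^sub>R v)"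
      using mvt_very_simple[OF less_imp_le[OF t(1)] p] by blast
    define y1 y2 where "y1 = x + t *\<^sub>R u + s *\<^sub>R v" and "y2 = x + s *\<^sub>R v"
    have tN: "t * N < d"
    proof -
      have "t * (N + 1) < d"
        using t N by (simp add: field_simps)
      then show ?thesis
        using t by (simp add: algebra_simps)
    qed
    have n1: "norm (y1 - x) \<le> t * N"
    proof -
      have "norm (y1 - x) \<le> t * norm u + s * norm v"
        unfolding y1_def using s t norm_triangle_ineq[of "t *\<^sub>R u" "s *\<^sub>R v"] by (simp add: algebra_simps)
      also have "\<dots> \<le> t * norm u + t * norm v"
        using s by (intro add_mono mult_right_mono) auto
      finally show ?thesis
        by (simp add: N_def algebra_simps)
    qed
    have n2: "norm (y2 - x) \<le> t * N"
    proof -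
      have "norm (y2 - x) \<le> t * norm v"
        using s by (auto simp: y2_def intro!: mult_right_mono)
      also have "\<dots> \<le> t * N"
        using t by (auto simp: N_def intro!: mult_left_mono)
      finally show ?thesis .
    qed
    define R where "R y = g y - g x - H (y - x)" for y
    have R: "norm (R y) \<le> e * (t * N)" if "norm (y - x) \<le> t * N" for y
    proof -
      have "norm (R y) \<le> e * norm (y - x)"
        unfolding R_def using that tN by (intro rem) simp
      also have "\<dots> \<le> e * (t * N)"
        using that e by (intro mult_left_mono) auto
      finally show ?thesis .
    qed
    have "p t - p 0 - t\<^sup>2 * H u v = t * (R y1 - R y2) v"
      unfolding ps R_def y1_def[symmetric] y2_def[symmetric]
      by (simp add: y1_def y2_def blinfun.bilinear_simps algebra_simps power2_eq_square)
    then have "\<bar>p t - p 0 - t\<^sup>2 * H u v\<bar> = t * norm ((R y1 - R y2) v)"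
      using t by (simp add: abs_mult)
    also have "\<dots> \<le> t * (norm (R y1 - R y2) * norm v)"
      using t by (intro mult_left_mono norm_blinfun) auto
    also have "\<dots> \<le> t * ((e * (t * N) + e * (t * N)) * norm v)"
    proof -
      have "norm (R y1 - R y2) \<le> e * (t * N) + e * (t * N)"
        using R[OF n1] R[OF n2] norm_triangle_ineq4[of "R y1" "R y2"] by linarith
      then show ?thesis
        using t by (intro mult_left_mono mult_right_mono) auto
    qed
    also have "t * ((e * (t * N) + e * (t * N)) * norm v) = t\<^sup>2 * (2 * e * N * norm v)"
      by (simp add: algebra_simps power2_eq_square)
    also have "\<dots> \<le> \<epsilon> * t\<^sup>2"
      using e_le by (simp add: mult.commute[of \<epsilon>] mult_left_mono)
    finally show ?thesis
      by (simp add: p_def)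
  qed
  moreover have "d / (N + 1) > 0"
    using d N by simp
  ultimately show thesis
    using that by blast
qed

theorem second_derivative_symmetric:
  fixes f :: "'a::real_normed_vector \<Rightarrow> real" and g :: "'a \<Rightarrow> 'a dual" and H :: "'a dual_op"
  assumes f: "\<And>y. (f has_derivative blinfun_apply (g y)) (at y)"
    and g: "(g has_derivative blinfun_apply H) (at x)"
  shows "H u v = H v u"
proof (rule ccontr)
  assume "H u v \<noteq> H v u"
  then have "\<bar>H u v - H v u\<bar> / 4 > 0" (is "?e > 0")
    by simp
  obtain \<delta>1 where d1: "\<delta>1 > 0" "\<And>t. 0 < t \<Longrightarrow> t < \<delta>1 \<Longrightarrow>
    \<bar>f (x + t *\<^sub>R u + t *\<^sub>R v) - f (x + t *\<^sub>R u) - f (x + t *\<^sub>R v) + f x - t\<^sup>2 * H u v\<bar> \<le> ?e * t\<^sup>2"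
    using second_difference_bound[OF f g \<open>?e > 0\<close>] by metis
  obtain \<delta>2 where d2: "\<delta>2 > 0" "\<And>t. 0 < t \<Longrightarrow> t < \<delta>2 \<Longrightarrow>
    \<bar>f (x + t *\<^sub>R v + t *\<^sub>R u) - f (x + t *\<^sub>R v) - f (x + t *\<^sub>R u) + f x - t\<^sup>2 * H v u\<bar> \<le> ?e * t\<^sup>2"
    using second_difference_bound[OF f g \<open>?e > 0\<close>] by metis
  define t where "t = min \<delta>1 \<delta>2 / 2"
  have t: "0 < t" "t < \<delta>1" "t < \<delta>2"
    using d1(1) d2(1) by (auto simp: t_def)
  have "x + t *\<^sub>R v + t *\<^sub>R u = x + t *\<^sub>R u + t *\<^sub>R v"
    by (simp add: algebra_simps)
  then have "\<bar>t\<^sup>2 * H u v - t\<^sup>2 * H v u\<bar> \<le> 2 * (?e * t\<^sup>2)"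
    using d1(2)[OF t(1,2)] d2(2)[OF t(1,3)] by (simp only:)
  also have "\<bar>t\<^sup>2 * H u v - t\<^sup>2 * H v u\<bar> = 4 * ?e * t\<^sup>2"
    by (simp add: abs_mult flip: right_diff_distrib)
  finally show False
    using t \<open>?e > 0\<close> by (simp add: mult_le_0_iff)
qed

lemma grad_has_derivative: "twice_differentiable f \<Longrightarrow> (f has_derivative blinfun_apply (grad f x)) (at x)"
  unfolding grad_def twice_differentiable_def by (intro blinfun_deriv_has_derivative) simp

lemma hess_has_derivative: "twice_differentiable f \<Longrightarrow> (grad f has_derivative blinfun_apply (hess f x)) (at x)"
  unfolding hess_def twice_differentiable_def by (intro blinfun_deriv_has_derivative) simp

lemma self_adjoint_hess: "twice_differentiable f \<Longrightarrow> self_adjoint (hess f x)"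
  unfolding self_adjoint_def
  using second_derivative_symmetric grad_has_derivative hess_has_derivative by metis

section \<open>Strong self-concordance and mean Hessians\<close>

definition mean_hess :: "('a::euclidean_space \<Rightarrow> real) \<Rightarrow> 'a \<Rightarrow> 'a \<Rightarrow> 'a dual_op" where
  "mean_hess f x u = integral {0..1} (\<lambda>t. hess f (x + t *\<^sub>R u))"

locale strongly_self_concordant =
  fixes f :: "'a::euclidean_space \<Rightarrow> real" and M :: real
  assumes twice_diff: "twice_differentiable f"
    and positive_definite_hess: "\<And>y. positive_definite (hess f y)"
    and M_nonneg: "M \<ge> 0"
    and self_concordance:
      "\<And>x y z w. hess f y - hess f x \<preceq> (M * local_norm f z (y - x)) *\<^sub>R hess f w"
begin

lemma spd_hess: "spd (hess f y)"
  using self_adjoint_hess[OF twice_diff] positive_definite_hess by (simp add: spd_def)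

lemma local_norm_nonneg: "local_norm f z h \<ge> 0"
  by (simp add: local_norm_def spd_nonneg[OF spd_hess])

lemma local_norm_scaleR: "local_norm f z (c *\<^sub>R h) = \<bar>c\<bar> * local_norm f z h"
  by (simp add: local_norm_def blinfun.bilinear_simps real_sqrt_mult mult.assoc[symmetric])

lemma hess_change: "hess f y v v \<le> hess f x v v + M * local_norm f z (y - x) * hess f w v v"
  using self_concordance[of y x z w] by (simp add: op_le_iff blinfun.bilinear_simps algebra_simps)

text \<open>
  Strong self-concordance bounds \<open>\<nabla>\<^sup>2 f(y) - \<nabla>\<^sup>2 f(x)\<close> from both sides by a multiple of \<open>\<parallel>y - x\<parallel>\<^sub>x\<close>, so the Hessian
  is continuous and can be integrated along segments.
\<close>

lemma hess_quadratic_continuous: "isCont (\<lambda>y. hess f y v v) x"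
proof -
  have "((\<lambda>y. hess f y v v - hess f x v v) \<longlongrightarrow> 0) (at x)"
  proof (rule Lim_null_comparison)
    have "\<bar>hess f y v v - hess f x v v\<bar> \<le> M * local_norm f x (y - x) * hess f x v v" for y
      using hess_change[of y v x x x] hess_change[of x v y x x] local_norm_scaleR[of x "-1" "y - x"]
      by simp
    then show "\<forall>\<^sub>F y in at x. norm (hess f y v v - hess f x v v) \<le> M * local_norm f x (y - x) * hess f x v v"
      by (intro always_eventually) auto
    have "((\<lambda>y. M * sqrt (hess f x (y - x) (y - x)) * hess f x v v)
        \<longlongrightarrow> M * sqrt (hess f x (x - x) (x - x)) * hess f x v v) (at x)"
      by (intro tendsto_intros)
    then show "((\<lambda>y. M * local_norm f x (y - x) * hess f x v v) \<longlongrightarrow> 0) (at x)"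
      by (simp add: local_norm_def)
  qed
  then show ?thesis
    unfolding isCont_def by (rule LIM_zero_cancel)
qed

lemma hess_continuous: "continuous_on S (hess f)"
proof -
  have diag: "continuous_on S (\<lambda>y. hess f y v v)" for v
    using hess_quadratic_continuous by (intro continuous_at_imp_continuous_on) auto
  have "continuous_on S (\<lambda>y. hess f y i j)" for i j
  proof -
    have "hess f y i j = (hess f y (i + j) (i + j) - hess f y i i - hess f y j j) / 2" for y
      using spd_sym[OF spd_hess, of y j i] by (simp add: blinfun.bilinear_simps)
    moreover have "continuous_on S (\<lambda>y. (hess f y (i + j) (i + j) - hess f y i i - hess f y j j) / 2)"
      by (intro continuous_on_divide continuous_on_diff continuous_on_const diag) auto
    ultimately show ?thesis
      by presburger
  qed
  then have "continuous_on S (\<lambda>y. hess f y i)" for i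
    by (rule continuous_on_blinfun_componentwise)
  then show ?thesis
    by (rule continuous_on_blinfun_componentwise)
qed

lemma hess_line_integrable: "(\<lambda>t. hess f (x + t *\<^sub>R u)) integrable_on {0..1}"
  by (intro integrable_continuous_real continuous_on_compose2[OF hess_continuous[of UNIV]])
    (auto intro!: continuous_intros)

lemma mean_hess_has_integral:
  "((\<lambda>t. hess f (x + t *\<^sub>R u) v w) has_integral mean_hess f x u v w) {0..1}"
proof -
  have "((\<lambda>t. hess f (x + t *\<^sub>R u)) has_integral mean_hess f x u) {0..1}"
    using hess_line_integrable by (simp add: mean_hess_def integrable_integral)
  moreover have "bounded_linear (\<lambda>A :: 'a dual_op. A v w)"
    by (rule bounded_linear_compose[of "\<lambda>s. blinfun_apply s w" "\<lambda>A. blinfun_apply A v"])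
      (rule blinfun.bounded_linear_left)+
  ultimately show ?thesis
    using has_integral_linear[of _ _ _ "\<lambda>A :: 'a dual_op. blinfun_apply (blinfun_apply A v) w"] by (simp add: comp_def)
qed

lemma grad_increment: "grad f (x + u) - grad f x = mean_hess f x u u"
proof -
  have "((\<lambda>t. hess f (x + t *\<^sub>R u) u) has_integral (grad f (x + 1 *\<^sub>R u) - grad f (x + 0 *\<^sub>R u))) {0..1}"
  proof (rule fundamental_theorem_of_calculus)
    fix t :: real
    have "((\<lambda>t. grad f (x + t *\<^sub>R u)) has_derivative (\<lambda>h. hess f (x + t *\<^sub>R u) (h *\<^sub>R u))) (at t within {0..1})"
      by (rule has_derivative_compose[OF _ hess_has_derivative[OF twice_diff]])
        (auto intro!: derivative_eq_intros)
    then show "((\<lambda>t. grad f (x + t *\<^sub>R u)) has_vector_derivative hess f (x + t *\<^sub>R u) u) (at t within {0..1})"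
      by (simp add: has_vector_derivative_def blinfun.bilinear_simps)
  qed simp
  moreover have "((\<lambda>t. hess f (x + t *\<^sub>R u) u) has_integral mean_hess f x u u) {0..1}"
    using has_integral_linear[OF integrable_integral[OF hess_line_integrable]
        blinfun.bounded_linear_left[of u]]
    by (simp add: mean_hess_def comp_def)
  ultimately have "grad f (x + 1 *\<^sub>R u) - grad f (x + 0 *\<^sub>R u) = mean_hess f x u u"
    by (rule has_integral_unique)
  then show ?thesis
    by simp
qed

lemma self_adjoint_mean_hess: "self_adjoint (mean_hess f x u)"
  unfolding self_adjoint_def
proof (intro allI)
  fix v w
  have eq: "(\<lambda>t. hess f (x + t *\<^sub>R u) v w) = (\<lambda>t. hess f (x + t *\<^sub>R u) w v)"
    by (intro ext spd_sym spd_hess)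
  have "((\<lambda>t. hess f (x + t *\<^sub>R u) v w) has_integral mean_hess f x u w v) {0..1}"
    by (subst eq) (rule mean_hess_has_integral)
  then show "mean_hess f x u v w = mean_hess f x u w v"
    by (rule has_integral_unique[OF mean_hess_has_integral])
qed

text \<open>
  For the first bound the self-concordance inequality is integrated with \<open>w = y\<close>.  For the second bound
  the inequality holds with every \<open>w\<close>; choosing \<open>w\<close> on the segment and integrating once more over \<open>w\<close> makes
  the averaged Hessian appear on the right-hand side.
\<close>

lemma mean_hess_compare:
  assumes dist: "\<And>t. t \<in> {0..1} \<Longrightarrow> local_norm f x (x + t *\<^sub>R u - y) = d t * r"
    and d: "(d has_integral 1/2) {0..1}"
  shows "mean_hess f x u v v \<le> (1 + M * r / 2) * hess f y v v"
    and "hess f y v v \<le> (1 + M * r / 2) * mean_hess f x u v v"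
proof -
  have const: "((\<lambda>t. c + (M * r * b) * d t) has_integral (c + (M * r * b) * (1/2))) {0..1}" for b c :: real
    using has_integral_add[OF has_integral_const_real[of c 0 1] has_integral_mult_right[OF d, of "M * r * b"]]
    by simp
  have "mean_hess f x u v v \<le> hess f y v v + (M * r * hess f y v v) * (1/2)"
  proof (rule has_integral_le[OF mean_hess_has_integral const])
    fix t :: real assume "t \<in> {0..1}"
    then show "hess f (x + t *\<^sub>R u) v v \<le> hess f y v v + (M * r * hess f y v v) * d t"
      using hess_change[of "x + t *\<^sub>R u" v y x y] dist by (simp add: algebra_simps)
  qed
  then show "mean_hess f x u v v \<le> (1 + M * r / 2) * hess f y v v"
    by (simp add: algebra_simps)
  have any: "hess f y v v \<le> mean_hess f x u v v + (M * r / 2) * hess f w v v" for w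
  proof -
    have "hess f y v v + (M * r * (- hess f w v v)) * (1/2) \<le> mean_hess f x u v v"
    proof (rule has_integral_le[OF const mean_hess_has_integral])
      fix t :: real assume "t \<in> {0..1}"
      moreover have "local_norm f x (y - (x + t *\<^sub>R u)) = local_norm f x (x + t *\<^sub>R u - y)"
        using local_norm_scaleR[of x "-1" "y - (x + t *\<^sub>R u)"] by simp
      ultimately show "hess f y v v + (M * r * (- hess f w v v)) * d t \<le> hess f (x + t *\<^sub>R u) v v"
        using hess_change[of y v "x + t *\<^sub>R u" x w] dist by (simp add: algebra_simps)
    qed
    then show ?thesis
      by simp
  qed
  have upper: "((\<lambda>s. mean_hess f x u v v + (M * r / 2) * hess f (x + s *\<^sub>R u) v v) has_integral
      (mean_hess f x u v v + (M * r / 2) * mean_hess f x u v v)) {0..1}"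
    using has_integral_add[OF has_integral_const_real[of "mean_hess f x u v v" 0 1]
        has_integral_mult_right[OF mean_hess_has_integral[of x u v v], of "M * r / 2"]]
    by simp
  have const': "((\<lambda>s. hess f y v v) has_integral hess f y v v) {0..1::real}"
    using has_integral_const_real[of "hess f y v v" 0 1] by simp
  have "hess f y v v \<le> mean_hess f x u v v + (M * r / 2) * mean_hess f x u v v"
    by (rule has_integral_le[OF const' upper]) (rule any)
  then show "hess f y v v \<le> (1 + M * r / 2) * mean_hess f x u v v"
    by (simp add: algebra_simps)
qed

lemma mean_hess_bounds:
  fixes x u v
  defines "c \<equiv> 1 + M * local_norm f x u / 2"
  shows "mean_hess f x u v v \<le> c * hess f x v v"
    and "hess f x v v \<le> c * mean_hess f x u v v"
    and "mean_hess f x u v v \<le> c * hess f (x + u) v v"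
    and "hess f (x + u) v v \<le> c * mean_hess f x u v v"
proof -
  have id: "((\<lambda>t. t) has_integral (1/2)) {0..1::real}"
    using ident_has_integral[of 0 "1::real"] by simp
  have "local_norm f x (x + t *\<^sub>R u - x) = t * local_norm f x u" if "t \<in> {0..1}" for t
    using that local_norm_scaleR[of x t u] by simp
  note 1 = mean_hess_compare[OF this id]
  show "mean_hess f x u v v \<le> c * hess f x v v" "hess f x v v \<le> c * mean_hess f x u v v"
    unfolding c_def by (rule 1; assumption)+
  have id': "((\<lambda>t. 1 - t) has_integral (1/2)) {0..1::real}"
    using has_integral_diff[OF has_integral_const_real[of 1 0 1] id] by simp
  have "local_norm f x (x + t *\<^sub>R u - (x + u)) = (1 - t) * local_norm f x u" if "t \<in> {0..1}" for t
    using that local_norm_scaleR[of x "t - 1" u] by (simp add: algebra_simps)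
  note 2 = mean_hess_compare[OF this id']
  show "mean_hess f x u v v \<le> c * hess f (x + u) v v" "hess f (x + u) v v \<le> c * mean_hess f x u v v"
    unfolding c_def by (rule 2; assumption)+
qed

lemma spd_mean_hess: "spd (mean_hess f x u)"
proof -
  have "mean_hess f x u v v > 0" if "v \<noteq> 0" for v
  proof -
    define c where "c = 1 + M * local_norm f x u / 2"
    have "c > 0"
      using M_nonneg local_norm_nonneg[of x u] by (auto simp: c_def intro!: add_pos_nonneg)
    have "0 < hess f x v v"
      using spd_pos[OF spd_hess that] .
    also have "\<dots> \<le> c * mean_hess f x u v v"
      unfolding c_def by (rule mean_hess_bounds)
    finally show ?thesis
      using \<open>c > 0\<close> by (simp add: zero_less_mult_iff)
  qed
  then show ?thesis
    using self_adjoint_mean_hess by (simp add: spd_def positive_definite_def)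
qed

end

section \<open>Convergence of the iteration\<close>

text \<open>
  The inequality between the arithmetic and the geometric mean, without roots.
\<close>

lemma prod_le_mean_power:
  fixes a :: "nat \<Rightarrow> real"
  assumes k: "k \<ge> 1" and a: "\<And>i. i < k \<Longrightarrow> a i \<ge> 0"
  shows "(\<Prod>i<k. a i) \<le> ((\<Sum>i<k. a i) / k) ^ k"
proof -
  define p m where "p = (\<Prod>i<k. a i)" and "m = (\<Sum>i<k. a i) / k"
  have p: "p \<ge> 0" and m: "m \<ge> 0"
    unfolding p_def m_def using a by (auto intro!: prod_nonneg divide_nonneg_nonneg sum_nonneg)
  have "p \<le> m ^ k"
  proof (cases "p = 0")
    case False
    have "p powr (1 / k) \<le> m"
      using arith_geom_mean[of "{..<k}" a] a k
      by (simp add: p_def m_def sum_divide_distrib lessThan_empty_iff)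
    then have "(p powr (1 / k)) ^ k \<le> m ^ k"
      by (intro power_mono) auto
    also have "(p powr (1 / k)) ^ k = (p powr (1 / k)) powr k"
      using p False by (simp add: powr_realpow)
    also have "\<dots> = p"
      using p k by (simp add: powr_powr)
    finally show ?thesis .
  qed (use m in simp)
  then show ?thesis
    by (simp add: p_def m_def)
qed

text \<open>
  The iteration in the normalization \<open>\<eta> = L/\<mu>\<close>.  Of the operator \<open>B\<close> only the consequence
  \<open>\<nabla>\<^sup>2 f(x\<^sub>0) \<preceq> G\<^sub>0 \<preceq> \<eta> \<nabla>\<^sup>2 f(x\<^sub>0)\<close> is kept.
\<close>

locale broyden_iteration = strongly_self_concordant f M
  for f :: "'a::euclidean_space \<Rightarrow> real" and M :: real +
  fixes \<phi> :: "nat \<Rightarrow> real" and x :: "nat \<Rightarrow> 'a" and G :: "nat \<Rightarrow> 'a dual_op" and \<eta> :: real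
  assumes phi: "0 \<le> \<phi> i" "\<phi> i \<le> 1"
    and eta: "\<eta> \<ge> 1"
    and spd_G0: "spd (G 0)"
    and G0_lower: "hess f (x 0) v v \<le> G 0 v v"
    and G0_upper: "G 0 v v \<le> \<eta> * hess f (x 0) v v"
    and step: "x (Suc i) = x i - op_inv (G i) (grad f (x i))"
    and update: "G (Suc i) = broyd (\<phi> i) (mean_hess f (x i) (x (Suc i) - x i)) (G i) (x (Suc i) - x i)"
    and start: "M * newton_decrement f (x 0) \<le> ln (3 / 2) / (4 * \<eta>)"
begin

abbreviation "u i \<equiv> x (Suc i) - x i"
abbreviation "g i \<equiv> grad f (x i)"
abbreviation "H i \<equiv> hess f (x i)"
abbreviation "J i \<equiv> mean_hess f (x i) (u i)"
abbreviation "r i \<equiv> local_norm f (x i) (u i)"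
abbreviation "lam i \<equiv> newton_decrement f (x i)"

text \<open>
  The total change of the Hessian along the path: \<open>exp (drift k)\<close> bounds the factor by which the Hessians
  at \<open>x\<^sub>0\<close> and \<open>x\<^sub>k\<close> differ, in either direction.
\<close>

definition drift :: "nat \<Rightarrow> real" where
  "drift k = M * (\<Sum>i<k. r i)"

text \<open>
  The squared ratio of the dual norms of the new gradient \<open>J u - G u\<close> and the old gradient \<open>- G u\<close>, both
  measured with the mean Hessian \<open>J\<close>.  It is \<open>0/0 = 0\<close> once the iteration has become stationary.
\<close>

definition reduction :: "nat \<Rightarrow> real" where
  "reduction k = dual_form (J k) (G k (u k) - J k (u k)) / dual_form (J k) (G k (u k))"

abbreviation "weight i \<equiv> \<phi> i / \<eta> + 1 - \<phi> i"

lemma drift_0: "drift 0 = 0" and drift_Suc: "drift (Suc k) = drift k + M * r k"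
  by (simp_all add: drift_def algebra_simps)

lemma Mr_nonneg: "M * r k \<ge> 0"
  using M_nonneg local_norm_nonneg by (intro mult_nonneg_nonneg)

lemma drift_nonneg: "drift k \<ge> 0"
  unfolding drift_def using M_nonneg local_norm_nonneg by (intro mult_nonneg_nonneg sum_nonneg) auto

lemma lam_nonneg: "lam k \<ge> 0"
  by (simp add: newton_decrement_eq dual_form_nonneg[OF spd_hess])

lemma lam_sq: "(lam k)\<^sup>2 = dual_form (H k) (g k)"
  by (simp add: newton_decrement_eq dual_form_nonneg[OF spd_hess])

lemma exp_bound:
  assumes "a \<le> (1 + M * r k / 2) * b" and "b \<ge> 0"
  shows "a \<le> exp (M * r k / 2) * b"
  using assms(1) mult_right_mono[OF exp_ge_add_one_self assms(2)] by (rule order_trans)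

lemma J_le_H: "J k v v \<le> exp (M * r k / 2) * H k v v"
  and H_le_J: "H k v v \<le> exp (M * r k / 2) * J k v v"
  and J_le_H_Suc: "J k v v \<le> exp (M * r k / 2) * H (Suc k) v v"
  and H_Suc_le_J: "H (Suc k) v v \<le> exp (M * r k / 2) * J k v v"
  using mean_hess_bounds[where x = "x k" and u = "u k" and v = v]
  by (auto intro!: exp_bound simp: spd_nonneg[OF spd_hess] spd_nonneg[OF spd_mean_hess])

lemma exp_mono_chain:
  fixes a b c s t :: real
  assumes "a \<le> exp s * b" "b \<le> exp t * c"
  shows "a \<le> exp (s + t) * c"
proof -
  have "exp s * b \<le> exp s * (exp t * c)"
    using assms(2) by (intro mult_left_mono) auto
  with assms(1) have "a \<le> exp s * (exp t * c)"
    by (rule order_trans)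
  then show ?thesis
    by (simp add: exp_add mult.assoc)
qed

text \<open>
  The updates preserve two-sided bounds of \<open>G\<close> with respect to the mean Hessian.  Each step passes from
  \<open>H\<^sub>k\<close> to \<open>J\<^sub>k\<close> before the update and from \<open>J\<^sub>k\<close> to \<open>H\<^sub>k\<^sub>+\<^sub>1\<close> after it; either passage costs \<open>exp (M r\<^sub>k / 2)\<close>.
\<close>

lemma G_bounds_induct:
  "spd (G k) \<and> (\<forall>v. H k v v \<le> exp (drift k) * G k v v \<and> G k v v \<le> exp (drift k) * (\<eta> * H k v v))"
proof (induction k)
  case 0
  then show ?case
    using spd_G0 G0_lower G0_upper by (simp add: drift_0)
next
  case (Suc k)
  define \<xi> where "\<xi> = exp (drift k + M * r k / 2)"
  have xi: "\<xi> \<ge> 1"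
    using drift_nonneg[of k] Mr_nonneg[of k] by (simp add: \<xi>_def)
  have spd: "spd (G k)" "spd (J k)"
    using Suc spd_mean_hess by auto
  have lower: "J k v v \<le> \<xi> * G k v v" for v
    using exp_mono_chain[OF J_le_H, of k v "drift k" "G k v v"] Suc
    by (simp add: \<xi>_def add.commute)
  have upper: "G k v v \<le> \<xi> * \<eta> * J k v v" for v
    using exp_mono_chain[of "G k v v" "drift k" "\<eta> * H k v v" "M * r k / 2" "\<eta> * J k v v"] Suc
      mult_left_mono[OF H_le_J, of \<eta> k v] eta
    by (simp add: \<xi>_def mult.left_commute mult.assoc)
  have xieta: "\<xi> * \<eta> \<ge> 1"
    using xi eta mult_mono[of 1 \<xi> 1 \<eta>] by simp
  have l: "J k v v \<le> \<xi> * G (Suc k) v v" for v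
    unfolding update by (rule broyd_lower[OF spd(2,1) phi xi lower])
  have u: "G (Suc k) v v \<le> \<xi> * \<eta> * J k v v" for v
    unfolding update by (rule broyd_upper[OF spd(2,1) phi xieta upper])
  have "H (Suc k) v v \<le> exp (drift (Suc k)) * G (Suc k) v v" for v
    using exp_mono_chain[OF H_Suc_le_J l[unfolded \<xi>_def]] by (simp add: drift_Suc algebra_simps)
  moreover have "G (Suc k) v v \<le> exp (drift (Suc k)) * (\<eta> * H (Suc k) v v)" for v
    using exp_mono_chain[of "G (Suc k) v v" "drift k + M * r k / 2" "\<eta> * J k v v" "M * r k / 2" "\<eta> * H (Suc k) v v"]
      u[of v] mult_left_mono[OF J_le_H_Suc, of \<eta> k v] eta
    by (simp add: drift_Suc \<xi>_def mult.left_commute mult.assoc add.assoc)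
  moreover have "spd (G (Suc k))"
    unfolding update by (rule spd_broyd[OF spd(2,1) phi])
  ultimately show ?case
    by blast
qed

lemma spd_G: "spd (G k)"
  and H_le_G: "H k v v \<le> exp (drift k) * G k v v"
  and G_le_H: "G k v v \<le> exp (drift k) * (\<eta> * H k v v)"
  using G_bounds_induct[of k] by auto

lemma J_le_G: "J k v v \<le> exp (drift k + M * r k / 2) * G k v v"
  using exp_mono_chain[OF J_le_H H_le_G, of k v] by (simp add: add.commute)

lemma G_le_J: "G k v v \<le> exp (drift k + M * r k / 2) * \<eta> * J k v v"
  using exp_mono_chain[OF G_le_H, of k v "M * r k / 2" "\<eta> * J k v v"] mult_left_mono[OF H_le_J, of \<eta> k v] eta
  by (simp add: mult.left_commute mult.assoc)

lemma G_u: "G k (u k) = - g k"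
proof -
  have "u k = - op_inv (G k) (g k)"
    by (simp add: step)
  then show ?thesis
    using spd_G by (simp only: blinfun.minus_right op_inv_right)
qed

lemma grad_Suc: "g (Suc k) = - (G k (u k) - J k (u k))"
  using grad_increment[of "x k" "u k"] G_u[of k] by (simp add: algebra_simps)

lemma r_le: "r k \<le> exp (drift k) * lam k"
proof -
  let ?e = "exp (drift k)"
  have "H k (u k) (u k) \<le> ?e * G k (u k) (u k)"
    by (rule H_le_G)
  also have "G k (u k) (u k) = dual_form (G k) (g k)"
    using dual_form_apply[OF spd_G, of k "u k"] dual_form_minus[OF spd_G, of k "g k"]
    unfolding G_u by simp
  also have "?e * dual_form (G k) (g k) \<le> ?e * (?e * dual_form (H k) (g k))"
    by (intro mult_left_mono dual_form_antimono[OF spd_hess spd_G _ H_le_G]) auto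
  also have "\<dots> = (?e * lam k)\<^sup>2"
    by (simp add: power_mult_distrib lam_sq power2_eq_square[of ?e])
  finally have "sqrt (H k (u k) (u k)) \<le> ?e * lam k"
    using lam_nonneg by (intro real_le_lsqrt) auto
  then show ?thesis
    by (simp add: local_norm_def)
qed

lemma reduction_nonneg: "reduction k \<ge> 0"
  unfolding reduction_def by (intro divide_nonneg_nonneg dual_form_nonneg spd_mean_hess)

lemma lam_Suc_sq: "(lam (Suc k))\<^sup>2 \<le> exp (M * r k) * reduction k * (lam k)\<^sup>2"
proof -
  let ?c = "exp (M * r k / 2)" and ?w = "G k (u k)"
  have "(lam (Suc k))\<^sup>2 = dual_form (H (Suc k)) (?w - J k (u k))"
    unfolding lam_sq grad_Suc by (rule dual_form_minus[OF spd_hess])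
  also have "\<dots> \<le> ?c * dual_form (J k) (?w - J k (u k))"
    by (rule dual_form_antimono[OF spd_mean_hess spd_hess _ J_le_H_Suc]) simp
  also have "dual_form (J k) (?w - J k (u k)) = reduction k * dual_form (J k) ?w"
  proof (cases "u k = 0")
    case True
    then have "dual_form (J k) (?w - J k (u k)) = 0" "dual_form (J k) ?w = 0"
      by (simp_all add: dual_form_def)
    then show ?thesis
      by simp
  next
    case False
    then have "?w \<noteq> 0"
      using spd_pos[OF spd_G False, of k] by auto
    then have "dual_form (J k) ?w \<noteq> 0"
      by (simp add: dual_form_eq_0_iff[OF spd_mean_hess])
    then show ?thesis
      by (simp add: reduction_def)
  qed
  also have "dual_form (J k) ?w \<le> ?c * dual_form (H k) ?w"
    by (rule dual_form_antimono[OF spd_hess spd_mean_hess _ H_le_J]) simp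
  also have "dual_form (H k) ?w = (lam k)\<^sup>2"
    unfolding G_u dual_form_minus[OF spd_hess] lam_sq ..
  also have "?c * (reduction k * (?c * (lam k)\<^sup>2)) = exp (M * r k / 2 + M * r k / 2) * reduction k * (lam k)\<^sup>2"
    by (simp only: exp_add) (simp add: algebra_simps)
  finally show ?thesis
    using reduction_nonneg[of k] by (simp add: mult_left_mono)
qed

text \<open>
  With \<open>2/3 J \<preceq> G \<preceq> 3/2 \<eta> J\<close>, the residual lemma applies with \<open>p = 3/2\<close> and \<open>q = 1/(2 \<eta>)\<close>.  The larger
  value \<open>q = 2/(3 \<eta>)\<close> could violate \<open>p + q \<le> 2\<close> when \<open>\<eta>\<close> is close to 1.
\<close>

lemma reduction_le:
  assumes "drift k + M * r k / 2 \<le> ln (3 / 2)"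
  shows "reduction k \<le> (1 - 1 / (2 * \<eta>))\<^sup>2"
proof -
  have e: "exp (drift k + M * r k / 2) \<le> 3 / 2"
    using assms exp_le_cancel_iff[of _ "ln (3/2 :: real)"] by simp
  have lower: "J k v v \<le> 3 / 2 * G k v v" for v
    using J_le_G[of k v] mult_right_mono[OF e, of "G k v v"] spd_nonneg[OF spd_G, of k v] by linarith
  have upper: "1 / (2 * \<eta>) * G k v v \<le> J k v v" for v
  proof -
    have j: "J k v v \<ge> 0"
      by (rule spd_nonneg[OF spd_mean_hess])
    have "G k v v \<le> exp (drift k + M * r k / 2) * (\<eta> * J k v v)"
      using G_le_J[of k v] by (simp add: mult.assoc)
    also have "\<dots> \<le> 3 / 2 * (\<eta> * J k v v)"
      using e j eta by (intro mult_right_mono) auto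
    also have "\<dots> \<le> 2 * (\<eta> * J k v v)"
      using j eta by simp
    finally show ?thesis
      using eta by (simp add: field_simps)
  qed
  have "dual_form (J k) (G k (u k) - J k (u k)) \<le> (1 - 1 / (2 * \<eta>))\<^sup>2 * dual_form (J k) (G k (u k))"
    using eta by (intro dual_form_residual_le[OF spd_mean_hess spd_G _ _ _ lower upper]) (auto simp: field_simps)
  then show ?thesis
    using dual_form_nonneg[OF spd_mean_hess, of "x k" "u k" "G k (u k)"]
    by (cases "dual_form (J k) (G k (u k)) = 0") (auto simp: reduction_def field_simps)
qed

text \<open>
  The drift stays bounded because the local norms of the steps decay geometrically, while the decay
  needs the drift to be bounded.  The invariant resolves this circularity without summing a series: in
  every step the decrement loses at least the fraction \<open>3/(8 \<eta>)\<close>, so that \<open>4 \<eta> M \<lambda>\<close> drops by \<open>3/2 M \<lambda>\<close>, and this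
  pays for the increase \<open>M r \<le> 3/2 M \<lambda>\<close> of the drift.
\<close>

lemma drift_invariant: "drift k + 4 * \<eta> * (M * lam k) \<le> ln (3 / 2)"
proof (induction k)
  case 0
  then show ?case
    using start eta by (simp add: drift_0 field_simps)
next
  case (Suc k)
  have Mlam: "M * lam k \<ge> 0"
    using M_nonneg lam_nonneg by simp
  then have eta_lam: "4 * \<eta> * (M * lam k) \<ge> 4 * (M * lam k)"
    using eta mult_right_mono[of 1 \<eta> "M * lam k"] by simp
  have "drift k \<le> ln (3 / 2)"
    using Suc eta_lam Mlam by linarith
  then have "exp (drift k) \<le> 3 / 2"
    using exp_le_cancel_iff[of _ "ln (3/2 :: real)"] by simp
  then have "r k \<le> 3 / 2 * lam k"
    using r_le[of k] mult_right_mono[of "exp (drift k)" "3/2" "lam k"] lam_nonneg[of k] by linarith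
  then have Mr: "M * r k \<le> 3 / 2 * (M * lam k)"
    using M_nonneg mult_left_mono[of "r k" "3 / 2 * lam k" M] by simp
  \<comment> \<open>In terms of \<open>t = 1/\<eta>\<close> the contraction factor \<open>exp z (1 - t/2)\<close> is to be at most \<open>1 - 3/8 t\<close>; since
    \<open>exp z \<le> 1/(1 - z)\<close>, this follows from \<open>z \<le> 3/32 t\<close>.\<close>
  define t where "t = 1 / \<eta>"
  have t: "0 < t" "t \<le> 1"
    using eta by (auto simp: t_def)
  define z where "z = M * r k / 2"
  have "ln (3 / 2 :: real) \<le> 1 / 2"
    using ln_le_minus_one[of "3 / 2 :: real"] by simp
  then have "4 * \<eta> * (M * lam k) \<le> 1 / 2"
    using Suc drift_nonneg[of k] by linarith
  then have "M * lam k \<le> t / 8"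
    using eta by (simp add: t_def field_simps)
  then have z: "z \<le> 3 / 32 * t" "0 \<le> z"
    using Mr Mr_nonneg[of k] by (auto simp: z_def)
  have red: "reduction k \<le> (1 - t / 2)\<^sup>2"
    using reduction_le[of k] Mr eta_lam Suc Mlam Mr_nonneg[of k] by (simp add: t_def mult.commute)
  have "exp z * (1 - t / 2) \<le> 1 - 3 / 8 * t"
  proof -
    have "1 - z > 0"
      using z t by linarith
    have "exp z * (1 - z) \<le> exp z * exp (- z)"
      using exp_ge_add_one_self[of "- z"] by (intro mult_left_mono) auto
    then have ez: "exp z * (1 - z) \<le> 1"
      by (simp flip: exp_add)
    have "1 - t / 2 \<le> (1 - 3 / 8 * t) * (1 - 3 / 32 * t)"
      using t by (simp add: algebra_simps)
    also have "\<dots> \<le> (1 - 3 / 8 * t) * (1 - z)"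
      using z t by (intro mult_left_mono) auto
    finally have "exp z * (1 - t / 2) \<le> exp z * ((1 - 3 / 8 * t) * (1 - z))"
      by (intro mult_left_mono) auto
    also have "\<dots> = (1 - 3 / 8 * t) * (exp z * (1 - z))"
      by simp
    also have "\<dots> \<le> (1 - 3 / 8 * t) * 1"
      using ez t by (intro mult_left_mono) auto
    finally show ?thesis
      by simp
  qed
  moreover have "lam (Suc k) \<le> exp z * (1 - t / 2) * lam k"
  proof -
    have "(lam (Suc k))\<^sup>2 \<le> exp (M * r k) * reduction k * (lam k)\<^sup>2"
      by (rule lam_Suc_sq)
    also have "\<dots> \<le> exp (M * r k) * (1 - t / 2)\<^sup>2 * (lam k)\<^sup>2"
      using red by (intro mult_right_mono mult_left_mono) auto
    also have "exp (M * r k) = (exp z)\<^sup>2"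
      by (simp add: z_def power2_eq_square flip: exp_add)
    finally have "(lam (Suc k))\<^sup>2 \<le> (exp z * (1 - t / 2) * lam k)\<^sup>2"
      by (simp add: power_mult_distrib)
    then show ?thesis
      by (rule power2_le_imp_le) (use t lam_nonneg[of k] in simp)
  qed
  ultimately have "lam (Suc k) \<le> (1 - 3 / 8 * t) * lam k"
    using lam_nonneg[of k] mult_right_mono[of "exp z * (1 - t / 2)" "1 - 3 / 8 * t" "lam k"]
    by linarith
  then have "M * lam (Suc k) \<le> (1 - 3 / 8 * t) * (M * lam k)"
    using M_nonneg mult_left_mono[of "lam (Suc k)" _ M] by (simp add: mult.left_commute)
  then have "4 * \<eta> * (M * lam (Suc k)) \<le> 4 * \<eta> * ((1 - 3 / 8 * t) * (M * lam k))"
    using eta by (intro mult_left_mono) auto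
  also have "\<dots> = 4 * \<eta> * (M * lam k) - 3 / 2 * (M * lam k)"
    using eta by (simp add: t_def field_simps)
  finally show ?case
    using Suc Mr by (simp add: drift_Suc)
qed

lemma drift_half_le: "drift k + M * r k / 2 \<le> ln (3 / 2)"
  and drift_le: "drift k \<le> ln (3 / 2)"
proof -
  have "0 \<le> 4 * \<eta> * (M * lam j)" for j
    using M_nonneg lam_nonneg eta by (intro mult_nonneg_nonneg) auto
  then have le: "drift j \<le> ln (3 / 2)" for j
    using drift_invariant[of j] by (smt (verit))
  then show "drift k \<le> ln (3 / 2)" .
  show "drift k + M * r k / 2 \<le> ln (3 / 2)"
    using le[of "Suc k"] Mr_nonneg[of k] by (simp add: drift_Suc)
qed

lemma weight_pos: "weight i > 0"
proof -
  have "\<phi> i / \<eta> \<ge> \<phi> i * 0" "\<phi> i = 1 \<Longrightarrow> \<phi> i / \<eta> > 0"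
    using phi[of i] eta by auto
  then show ?thesis
    using phi[of i] by (cases "\<phi> i = 1") auto
qed

lemma potential_step:
  "potential (J k) (G (Suc k)) + weight k * reduction k / (3 / 2) ^ 3 \<le> potential (J k) (G k)"
proof -
  let ?e = "exp (drift k + M * r k / 2)"
  have e: "?e \<le> 3 / 2"
    using drift_half_le exp_le_cancel_iff[of _ "ln (3/2 :: real)"] by simp
  have lower: "J k v v \<le> 3 / 2 * G k v v" for v
    using J_le_G[of k v] mult_right_mono[OF e, of "G k v v"] spd_nonneg[OF spd_G, of k v] by linarith
  have upper: "G k v v \<le> 3 / 2 * \<eta> * J k v v" for v
  proof -
    have "?e * \<eta> * J k v v \<le> 3 / 2 * \<eta> * J k v v"
      using e eta spd_nonneg[OF spd_mean_hess] by (intro mult_right_mono) auto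
    then show ?thesis
      using G_le_J[of k v] by linarith
  qed
  show ?thesis
    unfolding update reduction_def
    by (rule potential_broyd_decrease[OF spd_mean_hess spd_G phi _ eta lower upper]) simp
qed

text \<open>
  Replacing \<open>J\<^sub>k\<close> by \<open>J\<^sub>k\<^sub>+\<^sub>1\<close> multiplies the potential by at most \<open>exp ((M r\<^sub>k + M r\<^sub>k\<^sub>+\<^sub>1) / 2)\<close>; these factors
  multiply up to the exponential on the right-hand side, which never exceeds \<open>3/2\<close>.
\<close>

lemma potential_sum:
  "potential (J k) (G k) + (\<Sum>i<k. weight i * reduction i / (3 / 2) ^ 3)
    \<le> exp (drift k + M * r k / 2) * (real DIM('a) * (\<eta> + 1))"
proof (induction k)
  case 0
  have "rel_trace (J 0) (G 0) \<le> exp (drift 0 + M * r 0 / 2) * \<eta> * rel_trace (J 0) (J 0)"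
    by (rule rel_trace_mono[OF G_le_J])
  moreover have "rel_trace (G 0) (J 0) \<le> exp (drift 0 + M * r 0 / 2) * rel_trace (G 0) (G 0)"
    by (rule rel_trace_mono[OF J_le_G])
  ultimately have "potential (J 0) (G 0)
      \<le> exp (drift 0 + M * r 0 / 2) * (real DIM('a) * (\<eta> + 1))"
    unfolding potential_def rel_trace_self[OF spd_mean_hess] rel_trace_self[OF spd_G]
    by (simp add: algebra_simps)
  then show ?case
    by simp
next
  case (Suc k)
  let ?D = "\<lambda>i. weight i * reduction i / (3 / 2) ^ 3"
  define s where "s = M * r k / 2 + M * r (Suc k) / 2"
  have D: "?D i \<ge> 0" for i
    using weight_pos[of i] reduction_nonneg[of i] by (intro divide_nonneg_nonneg mult_nonneg_nonneg) auto
  have s: "exp s \<ge> 1"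
    using Mr_nonneg[of k] Mr_nonneg[of "Suc k"] by (simp add: s_def)
  have "J k v v \<le> exp s * J (Suc k) v v" for v
    unfolding s_def by (rule exp_mono_chain[OF J_le_H_Suc H_le_J])
  moreover have "J (Suc k) v v \<le> exp s * J k v v" for v
    using exp_mono_chain[OF J_le_H H_Suc_le_J, of k v] by (simp add: s_def add.commute)
  ultimately have "potential (J (Suc k)) (G (Suc k)) \<le> exp s * potential (J k) (G (Suc k))"
    by (intro potential_drift[OF spd_mean_hess spd_mean_hess spd_G]) auto
  also have "\<dots> \<le> exp s * (potential (J k) (G k) - ?D k)"
    using potential_step[of k] by (intro mult_left_mono) auto
  finally have "potential (J (Suc k)) (G (Suc k)) + (\<Sum>i<Suc k. ?D i)
      \<le> exp s * (potential (J k) (G k) - ?D k) + 1 * (\<Sum>i<Suc k. ?D i)"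
    by simp
  also have "\<dots> \<le> exp s * (potential (J k) (G k) - ?D k) + exp s * (\<Sum>i<Suc k. ?D i)"
    using s D by (intro add_left_mono mult_right_mono sum_nonneg) auto
  also have "\<dots> = exp s * (potential (J k) (G k) + (\<Sum>i<k. ?D i))"
    by (simp add: algebra_simps)
  also have "\<dots> \<le> exp s * (exp (drift k + M * r k / 2) * (real DIM('a) * (\<eta> + 1)))"
    using Suc by (intro mult_left_mono) auto
  also have "\<dots> = exp (s + (drift k + M * r k / 2)) * (real DIM('a) * (\<eta> + 1))"
    by (simp add: exp_add)
  also have "s + (drift k + M * r k / 2) = drift (Suc k) + M * r (Suc k) / 2"
    by (simp add: s_def drift_Suc)
  finally show ?case .
qed

text \<open>
  The potential ends above \<open>2 n\<close>, which absorbs the share of the second trace in its initial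
  value.  The factor \<open>(3/2)\<^sup>4\<close> collects \<open>\<xi>\<^sup>3\<close> from the decrease of the potential and \<open>3/2\<close> from the drift.
\<close>

lemma weighted_reduction_sum: "(\<Sum>i<k. weight i * reduction i) \<le> (3 / 2) ^ 4 * (real DIM('a) * \<eta>)"
proof (cases k)
  case 0
  then show ?thesis
    using eta by simp
next
  case (Suc m)
  define n where "n = real DIM('a)"
  have "2 * n + (\<Sum>i<k. weight i * reduction i / (3 / 2) ^ 3)
      \<le> potential (J m) (G k) + (\<Sum>i<k. weight i * reduction i / (3 / 2) ^ 3)"
    using potential_ge[OF spd_mean_hess spd_G] by (simp add: n_def)
  also have "\<dots> \<le> potential (J m) (G m) + (\<Sum>i<m. weight i * reduction i / (3 / 2) ^ 3)"
    using potential_step[of m] by (simp add: Suc)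
  also have "\<dots> \<le> exp (drift m + M * r m / 2) * (n * (\<eta> + 1))"
    unfolding n_def by (rule potential_sum)
  also have "\<dots> \<le> 3 / 2 * (n * (\<eta> + 1))"
    using drift_half_le[of m] exp_le_cancel_iff[of _ "ln (3/2 :: real)"] eta
    by (intro mult_right_mono) (auto simp: n_def)
  finally have "(\<Sum>i<k. weight i * reduction i / (3 / 2) ^ 3) \<le> 3 / 2 * (n * (\<eta> + 1)) - 2 * n"
    by linarith
  also have "\<dots> \<le> 3 / 2 * (n * \<eta>)"
    by (simp add: n_def algebra_simps)
  finally have "(\<Sum>i<k. weight i * reduction i) / (3 / 2) ^ 3 \<le> 3 / 2 * (n * \<eta>)"
    by (simp only: sum_divide_distrib)
  then show ?thesis
    by (simp add: n_def power_numeral_reduce)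
qed

lemma lam_sq_prod: "(lam k)\<^sup>2 \<le> exp (drift k) * (\<Prod>i<k. reduction i) * (lam 0)\<^sup>2"
proof (induction k)
  case 0
  then show ?case
    by (simp add: drift_0)
next
  case (Suc k)
  have "(lam (Suc k))\<^sup>2 \<le> exp (M * r k) * reduction k * (lam k)\<^sup>2"
    by (rule lam_Suc_sq)
  also have "\<dots> \<le> exp (M * r k) * reduction k * (exp (drift k) * (\<Prod>i<k. reduction i) * (lam 0)\<^sup>2)"
    using Suc reduction_nonneg[of k] by (intro mult_left_mono) auto
  also have "\<dots> = exp (drift (Suc k)) * (\<Prod>i<Suc k. reduction i) * (lam 0)\<^sup>2"
    by (simp add: drift_Suc exp_add)
  finally show ?case .
qed

text \<open>
  The arithmetic-geometric mean inequality turns the bound on the weighted sum of the reductions into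
  a bound on their product.  The remaining factor \<open>exp (drift k) \<le> 3/2 \<le> (3/2)\<^sup>k\<close> gives the constant
  \<open>(3/2)\<^sup>5 < 11\<close>.
\<close>

theorem superlinear_convergence:
  assumes k: "k \<ge> 1"
  shows "lam k \<le> 1 / (\<Prod>i<k. sqrt (weight i)) * (11 * real DIM('a) * \<eta> / real k) powr (real k / 2) * lam 0"
proof -
  define n where "n = real DIM('a)"
  define W where "W = (\<Prod>i<k. weight i)"
  define X where "X = 11 * n * \<eta> / real k"
  have X: "X > 0"
    using k eta by (simp add: X_def n_def)
  have W: "W > 0"
    unfolding W_def by (rule prod_pos) (rule weight_pos)
  define Y where "Y = (3 / 2) ^ 4 * (n * \<eta>) / real k"
  have Y: "Y \<ge> 0"
    using eta by (simp add: Y_def n_def)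
  have "W * (\<Prod>i<k. reduction i) = (\<Prod>i<k. weight i * reduction i)"
    by (simp add: W_def prod.distrib)
  also have "\<dots> \<le> ((\<Sum>i<k. weight i * reduction i) / k) ^ k"
    using weight_pos reduction_nonneg by (intro prod_le_mean_power[OF k] mult_nonneg_nonneg) (auto simp: less_imp_le)
  also have "\<dots> \<le> Y ^ k"
    unfolding Y_def n_def using weight_pos reduction_nonneg
    by (intro power_mono divide_right_mono weighted_reduction_sum divide_nonneg_nonneg sum_nonneg mult_nonneg_nonneg)
      (auto simp: less_imp_le)
  finally have WY: "W * (\<Prod>i<k. reduction i) \<le> Y ^ k" .
  have "W * (lam k)\<^sup>2 \<le> W * (exp (drift k) * (\<Prod>i<k. reduction i) * (lam 0)\<^sup>2)"
    using W lam_sq_prod by (intro mult_left_mono) auto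
  also have "\<dots> = exp (drift k) * (W * (\<Prod>i<k. reduction i)) * (lam 0)\<^sup>2"
    by simp
  also have "\<dots> \<le> (3 / 2) ^ k * Y ^ k * (lam 0)\<^sup>2"
  proof -
    have "exp (drift k) \<le> 3 / 2"
      using drift_le[of k] exp_le_cancel_iff[of _ "ln (3/2 :: real)"] by simp
    also have "\<dots> \<le> (3 / 2) ^ k"
      using k by (intro self_le_power) auto
    finally show ?thesis
      using WY W reduction_nonneg by (intro mult_right_mono mult_mono mult_nonneg_nonneg prod_nonneg) auto
  qed
  also have "(3 / 2) ^ k * Y ^ k = (3 / 2 * Y) ^ k"
    by (rule power_mult_distrib[symmetric])
  also have "\<dots> \<le> X ^ k"
  proof (rule power_mono)
    have "(3 / 2) ^ 5 * (n * \<eta> / k) \<le> 11 * (n * \<eta> / k)"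
      using eta by (intro mult_right_mono) (auto simp: n_def power_numeral_reduce)
    then show "3 / 2 * Y \<le> X"
      by (simp add: X_def Y_def power_numeral_reduce)
  qed (use Y in auto)
  also have "X ^ k = (X powr (real k / 2))\<^sup>2"
    using X by (simp add: powr_realpow[symmetric] powr_powr power2_eq_square flip: powr_add)
  finally have *: "W * (lam k)\<^sup>2 \<le> (X powr (real k / 2))\<^sup>2 * (lam 0)\<^sup>2"
    by (simp add: mult_right_mono)
  have "sqrt W * lam k \<le> X powr (real k / 2) * lam 0"
  proof (rule power2_le_imp_le)
    show "(sqrt W * lam k)\<^sup>2 \<le> (X powr (real k / 2) * lam 0)\<^sup>2"
      using * W by (simp add: power_mult_distrib)
  qed (use lam_nonneg[of 0] in auto)
  then have "lam k \<le> X powr (real k / 2) * lam 0 / sqrt W"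
    using W by (simp add: pos_le_divide_eq mult.commute)
  also have "sqrt W = (\<Prod>i<k. sqrt (weight i))"
    unfolding W_def by (induction k) (simp_all add: real_sqrt_mult)
  finally show ?thesis
    by (simp add: X_def n_def)
qed

end

theorem theorem4p2:
  fixes f :: "'a::euclidean_space \<Rightarrow> real"
    and B :: "'a dual_op"
    and \<mu> L M :: real
    and \<phi> :: "nat \<Rightarrow> real"
    and x u :: "nat \<Rightarrow> 'a"
    and G J :: "nat \<Rightarrow> 'a dual_op"
    and x0 :: 'a
    and k :: nat
  assumes "self_adjoint B" and "positive_definite B"
    and "\<mu> > 0" and "L > 0" and "M \<ge> 0"
    and "twice_differentiable f"
    and "\<And>y. \<mu> *\<^sub>R B \<preceq> hess f y"
    and "\<And>y. hess f y \<preceq> L *\<^sub>R B"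
    and "\<And>x y z w. hess f y - hess f x \<preceq> (M * local_norm f z (y - x)) *\<^sub>R hess f w"
    and "\<And>i. 0 \<le> \<phi> i \<and> \<phi> i \<le> 1"
    and "x 0 = x0"
    and "G 0 = L *\<^sub>R B"
    and "\<And>i. x (Suc i) = x i - op_inv (G i) (grad f (x i))"
    and "\<And>i. u i = x (Suc i) - x i"
    and "\<And>i. J i = integral {0..1} (\<lambda>t. hess f (x i + t *\<^sub>R u i))"
    and "\<And>i. G (Suc i) = broyd (\<phi> i) (J i) (G i) (u i)"
    and "M * newton_decrement f x0 \<le> ln (3 / 2) / 4 * (\<mu> / L)"
    and "k \<ge> 1"
  shows "newton_decrement f (x k) \<le>
           1 / (\<Prod>i<k. sqrt (\<phi> i * (\<mu> / L) + 1 - \<phi> i))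
             * (11 * real DIM('a) * L / (\<mu> * real k)) powr (real k / 2)
             * newton_decrement f x0"
proof -
  have B: "spd B"
    using assms(1,2) by (simp add: spd_def)
  have lower: "\<mu> * B v v \<le> hess f y v v" and upper: "hess f y v v \<le> L * B v v" for y v
    using assms(7,8) by (simp_all add: op_le_iff blinfun.bilinear_simps)
  obtain b :: 'a where "b \<in> Basis"
    using nonempty_Basis by blast
  then have "B b b > 0"
    using spd_pos[OF B] nonzero_Basis by blast
  moreover have "\<mu> * B b b \<le> L * B b b"
    using lower[of b x0] upper[of x0 b] by linarith
  ultimately have "\<mu> \<le> L"
    by simp
  have "positive_definite (hess f y)" for y
    unfolding positive_definite_def
  proof (intro allI impI)
    fix v :: 'a assume "v \<noteq> 0"
    then have "0 < \<mu> * B v v"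
      using spd_pos[OF B] assms(3) by simp
    then show "0 < hess f y v v"
      using lower[of v y] by linarith
  qed
  then interpret strongly_self_concordant f M
    using assms(5,6,9) by unfold_locales
  have "G 0 v v \<le> L / \<mu> * hess f (x 0) v v" for v
  proof -
    have "L / \<mu> * (\<mu> * B v v) \<le> L / \<mu> * hess f (x 0) v v"
      using assms(3,4) lower by (intro mult_left_mono) auto
    then show ?thesis
      using assms(3) by (simp add: assms(12) blinfun.bilinear_simps)
  qed
  then interpret broyden_iteration f M \<phi> x G "L / \<mu>"
    using assms \<open>\<mu> \<le> L\<close> upper spd_scaleR[OF B, of L]
    by unfold_locales (simp_all add: blinfun.bilinear_simps mean_hess_def)
  show ?thesis
    using superlinear_convergence[OF assms(18)] assms(11) by (simp add: mult.commute mult.left_commute)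
qed

end
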